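(* Suppose that $\{X_t,t\ge 0\}$ is a Lévy process on $\mathbb{R}^d$, $c>0$, $b>1$, and $M$ is an $\mathbb{R}^d$-valued random variable independent of $\{X_t\}$. Let $$Z_t=b^{-[ct]}M+b^{-[ct]}\int_0^{[ct]/c}b^{[cs]}\,dX_s,\qquad t\ge 0.$$ Then $\mathcal{L}(X_1)\in I_{\log}(\mathbb{R}^d)$ if and only if $Z_t$ converges in law to some $\mathbb{R}^d$-valued random variable as $t\to\infty$. This limit $\lim_{t\to\infty}\mathcal{L}(Z_t)$ is equal to $\mathcal{L}\left(\int_0^\infty b^{-[cs]-1}\,dX_s\right)$, which is semi-selfdecomposable with span $b$ and does not depend on $M$. Furthermore, if we let $\mathcal{L}(M):=\lim_{t\to\infty}\mathcal{L}(Z_t)$, then $\mathcal{L}(Z_t)=\mathcal{L}(M)$ for all $t\ge 0$.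
   Context: $\mathcal{L}(X)$ is the law of $X$; $[x]$ is the largest integer not greater than $x$. $I(\mathbb{R}^d)$ is the class of infinitely divisible distributions on $\mathbb{R}^d$, and $I_{\log}(\mathbb{R}^d)=\{\mu\in I(\mathbb{R}^d):\int_{\mathbb{R}^d}\log^+|x|\,\mu(dx)<\infty\}$ with $\log^+|x|=(\log|x|)\vee 0$. Stochastic integrals of nonrandom functions with respect to the Lévy process are over $(0,t]$; for the step functions here they are finite sums, e.g. $\int_0^{n/c}b^{[cs]}dX_s=\sum_{k=1}^{n}b^{k-1}(X_{k/c}-X_{(k-1)/c})$ for $n\in\{0,1,2,\dots\}$. The improper integral $\int_0^\infty f(s)\,dX_s$ is the limit in probability of $\int_0^t f(s)\,dX_s$ as $t\to\infty$, whenever it exists. A distribution $\mu\in I(\mathbb{R}^d)$ is semi-selfdecomposable with span $b>1$ if there exists $\rho\in I(\mathbb{R}^d)$ such that $\widehat\mu(z)=\widehat\mu(b^{-1}z)\widehat\rho(z)$ for all $z\in\mathbb{R}^d$, where $\widehat\mu$ is the characteristic function of $\mu$. *)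

theory Defs
  imports "HOL-Probability.Probability"
begin

text \<open>\<open>\<real>\<^sup>d\<close> is rendered as \<open>real ^ 'n\<close> with \<open>d = CARD('n)\<close>.\<close>

definition char_fun :: "(real ^ 'n) measure \<Rightarrow> real ^ 'n \<Rightarrow> complex" where
  "char_fun \<mu> z = (CLINT x|\<mu>. iexp (z \<bullet> x))"

definition borel_prob :: "(real ^ 'n) measure \<Rightarrow> bool" where
  "borel_prob \<mu> \<longleftrightarrow> prob_space \<mu> \<and> sets \<mu> = sets borel"

primrec conv_power :: "(real ^ 'n) measure \<Rightarrow> nat \<Rightarrow> (real ^ 'n) measure" where
  "conv_power \<nu> 0 = return borel 0"
| "conv_power \<nu> (Suc n) = convolution \<nu> (conv_power \<nu> n)"

definition infinitely_divisible :: "(real ^ 'n) measure \<Rightarrow> bool" where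
  "infinitely_divisible \<mu> \<longleftrightarrow>
     borel_prob \<mu> \<and> (\<forall>n\<ge>1. \<exists>\<nu>. borel_prob \<nu> \<and> \<mu> = conv_power \<nu> n)"

text \<open>Since \<open>ln 0 = 0\<close>, the integrand below vanishes at the origin, in agreement with
  \<open>log\<^sup>+ 0 = 0\<close>.\<close>

definition I_log :: "(real ^ 'n) measure \<Rightarrow> bool" where
  "I_log \<mu> \<longleftrightarrow> infinitely_divisible \<mu> \<and> (\<integral>\<^sup>+x. ennreal (max (ln (norm x)) 0) \<partial>\<mu>) < \<infinity>"

definition semi_selfdecomposable :: "real \<Rightarrow> (real ^ 'n) measure \<Rightarrow> bool" where
  "semi_selfdecomposable b \<mu> \<longleftrightarrow>
     b > 1 \<and> infinitely_divisible \<mu> \<and>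
     (\<exists>\<rho>. infinitely_divisible \<rho> \<and>
        (\<forall>z. char_fun \<mu> z = char_fun \<mu> (inverse b *\<^sub>R z) * char_fun \<rho> z))"

text \<open>Only the values \<open>X t\<close> for \<open>t \<ge> 0\<close> are constrained.\<close>

definition levy_process :: "'a measure \<Rightarrow> (real \<Rightarrow> 'a \<Rightarrow> real ^ 'n) \<Rightarrow> bool" where
  "levy_process P X \<longleftrightarrow>
     prob_space P \<and>
     (\<forall>t\<ge>0. X t \<in> borel_measurable P) \<and>
     (AE \<omega> in P. X 0 \<omega> = 0) \<and>
     (\<forall>n (t :: nat \<Rightarrow> real). 0 \<le> t 0 \<and> (\<forall>i<n. t i < t (Suc i)) \<longrightarrow>
        prob_space.indep_vars P (\<lambda>_. borel)
          (\<lambda>i \<omega>. if i = 0 then X (t 0) \<omega> else X (t i) \<omega> - X (t (i - 1)) \<omega>) {..n}) \<and>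
     (\<forall>s\<ge>0. \<forall>t\<ge>0. distr P borel (\<lambda>\<omega>. X (s + t) \<omega> - X s \<omega>) =
                    distr P borel (\<lambda>\<omega>. X t \<omega> - X 0 \<omega>)) \<and>
     (\<forall>t\<ge>0. \<forall>\<epsilon>>0.
        ((\<lambda>s. measure P {\<omega> \<in> space P. norm (X s \<omega> - X t \<omega>) > \<epsilon>}) \<longlongrightarrow> 0) (at t within {0..})) \<and>
     (AE \<omega> in P. \<forall>t\<ge>0. continuous (at_right t) (\<lambda>s. X s \<omega>) \<and>
        (t > 0 \<longrightarrow> (\<exists>l. ((\<lambda>s. X s \<omega>) \<longlongrightarrow> l) (at_left t))))"

text \<open>Independence of a random variable and the sigma-algebra generated by the whole process
  (the library's \<open>indep_var\<close> needs both variables to have the same type).\<close>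

definition indep_of_process ::
    "'a measure \<Rightarrow> ('a \<Rightarrow> real ^ 'n) \<Rightarrow> (real \<Rightarrow> 'a \<Rightarrow> real ^ 'n) \<Rightarrow> bool" where
  "indep_of_process P M X \<longleftrightarrow>
     prob_space.indep_set P
       {M -` A \<inter> space P | A. A \<in> sets borel}
       (sigma_sets (space P) {X t -` A \<inter> space P | t A. t \<ge> 0 \<and> A \<in> sets borel})"

text \<open>\<open>step_integral c f X t\<close> is the stochastic integral of \<open>f\<close> with respect to \<open>X\<close> over \<open>(0, t]\<close>,
  for \<open>t \<ge> 0\<close> and a nonrandom step function \<open>f\<close> that is constant on every interval
  \<open>[k/c, (k+1)/c)\<close>, such as \<open>s \<mapsto> g \<lfloor>c * s\<rfloor>\<close>; it is meaningful only for such \<open>f\<close>.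
  The last summand is the contribution of the incomplete interval \<open>(\<lfloor>c * t\<rfloor>/c, t]\<close>.\<close>

definition step_integral ::
    "real \<Rightarrow> (real \<Rightarrow> real) \<Rightarrow> (real \<Rightarrow> 'a \<Rightarrow> real ^ 'n) \<Rightarrow> real \<Rightarrow> 'a \<Rightarrow> real ^ 'n" where
  "step_integral c f X t \<omega> =
     (let n = nat \<lfloor>c * t\<rfloor> in
       (\<Sum>k=1..n. f ((real k - 1) / c) *\<^sub>R (X (real k / c) \<omega> - X ((real k - 1) / c) \<omega>))
       + f (real n / c) *\<^sub>R (X t \<omega> - X (real n / c) \<omega>))"

definition tendsto_in_prob ::
    "'a measure \<Rightarrow> ('i \<Rightarrow> 'a \<Rightarrow> real ^ 'n) \<Rightarrow> ('a \<Rightarrow> real ^ 'n) \<Rightarrow> 'i filter \<Rightarrow> bool" where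
  "tendsto_in_prob P Y L F \<longleftrightarrow>
     (\<forall>\<epsilon>>0. ((\<lambda>i. measure P {\<omega> \<in> space P. norm (Y i \<omega> - L \<omega>) > \<epsilon>}) \<longlongrightarrow> 0) F)"

text \<open>\<open>L\<close> is a version of the improper integral of \<open>f\<close> over \<open>(0, \<infinity>)\<close>.\<close>

definition has_improper_step_integral ::
    "'a measure \<Rightarrow> real \<Rightarrow> (real \<Rightarrow> real) \<Rightarrow> (real \<Rightarrow> 'a \<Rightarrow> real ^ 'n) \<Rightarrow> ('a \<Rightarrow> real ^ 'n) \<Rightarrow> bool" where
  "has_improper_step_integral P c f X L \<longleftrightarrow>
     L \<in> borel_measurable P \<and> tendsto_in_prob P (step_integral c f X) L at_top"

definition weakly_converges ::
    "('i \<Rightarrow> (real ^ 'n) measure) \<Rightarrow> (real ^ 'n) measure \<Rightarrow> 'i filter \<Rightarrow> bool" where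
  "weakly_converges \<mu> \<nu> F \<longleftrightarrow>
     (\<forall>f :: real ^ 'n \<Rightarrow> real. continuous_on UNIV f \<and> bounded (range f) \<longrightarrow>
        ((\<lambda>i. \<integral>x. f x \<partial>\<mu> i) \<longlongrightarrow> (\<integral>x. f x \<partial>\<nu>)) F)"

definition Z_proc ::
    "real \<Rightarrow> real \<Rightarrow> (real \<Rightarrow> 'a \<Rightarrow> real ^ 'n) \<Rightarrow> ('a \<Rightarrow> real ^ 'n) \<Rightarrow> real \<Rightarrow> 'a \<Rightarrow> real ^ 'n" where
  "Z_proc c b X M t \<omega> =
     b powi (- \<lfloor>c * t\<rfloor>) *\<^sub>R M \<omega> +
     b powi (- \<lfloor>c * t\<rfloor>) *\<^sub>R
       step_integral c (\<lambda>s. b powi \<lfloor>c * s\<rfloor>) X (of_int \<lfloor>c * t\<rfloor> / c) \<omega>"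

definition Z_limit ::
    "'a measure \<Rightarrow> real \<Rightarrow> real \<Rightarrow> (real \<Rightarrow> 'a \<Rightarrow> real ^ 'n) \<Rightarrow> ('a \<Rightarrow> real ^ 'n) \<Rightarrow> (real ^ 'n) measure \<Rightarrow> bool"
  where
  "Z_limit P c b X M \<mu> \<longleftrightarrow>
     borel_prob \<mu> \<and> weakly_converges (\<lambda>t. distr P borel (Z_proc c b X M t)) \<mu> at_top"

end

theory Submission
  imports Defs
begin

text \<open>Put \<open>r = 1/b\<close> and let \<open>\<nu>\<close> be the law of \<open>X\<^bsub>1/c\<^esub>\<close>. With \<open>n = \<lfloor>c t\<rfloor>\<close>, independence and
  stationarity of the increments \<open>\<xi>\<close> show that \<open>Z\<^sub>t\<close> has the law of \<open>r\<^sup>n M + W\<^sub>n\<close>, where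
  \<open>W\<^sub>n = \<Sum>\<^sub>k\<^sub>\<le>\<^sub>n r\<^sup>k \<xi>\<^sub>k\<close>: reversing the order of the summands does not change the law. If \<open>\<nu>\<close>
  has a logarithmic moment, Borel-Cantelli makes \<open>W\<^sub>n\<close> converge almost surely, and everything
  but necessity follows because the limit \<open>Y\<close> has the same law \<open>\<mu>\<close> as \<open>r (Y + \<xi>)\<close> with \<open>\<xi>\<close>
  independent of \<open>Y\<close>; an \<open>m\<close>-th convolution root of \<open>\<mu>\<close> is the limit law obtained from the finer
  grid with \<open>c m\<close> in place of \<open>c\<close>.

  For necessity, the characteristic function of \<open>W\<^sub>n\<close> dominates that of the limit in modulus.
  With \<open>\<phi>\<close> the characteristic function of \<open>\<nu>\<close>, \<open>\<Prod>\<^sub>k |\<phi>(r\<^sup>k z)|\<^sup>2\<close> is therefore bounded below for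
  small \<open>z\<close>, so \<open>\<Sum>\<^sub>k (1 - |\<phi>(r\<^sup>k z)|\<^sup>2)\<close> is bounded. Averaging over \<open>z\<close> on a coordinate axis bounds
  the sum of the tails of the symmetrization of \<open>\<nu>\<close> at geometric levels, which controls its
  logarithmic moment; Fubini removes the symmetrization.\<close>

section \<open>Convolution and dilation of laws\<close>

definition dilation :: "real \<Rightarrow> (real ^ 'n) measure \<Rightarrow> (real ^ 'n) measure" where
  "dilation r \<mu> = distr \<mu> borel (\<lambda>x. r *\<^sub>R x)"

lemma borel_probD:
  assumes "borel_prob \<mu>"
  shows "prob_space \<mu>" "finite_measure \<mu>" "sets \<mu> = sets borel" "space \<mu> = UNIV"
  using assms prob_space.axioms(1) sets_eq_imp_space_eq[of \<mu> borel]
  by (auto simp: borel_prob_def)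

lemma borel_prob_distr:
  assumes "prob_space P" "f \<in> borel_measurable P"
  shows "borel_prob (distr P borel f)"
  using assms by (simp add: borel_prob_def prob_space.prob_space_distr)

lemma borel_prob_return [simp]: "borel_prob (return borel x)"
  by (simp add: borel_prob_def prob_space_return)

lemma borel_prob_dilation [simp]: "borel_prob \<mu> \<Longrightarrow> borel_prob (dilation r \<mu>)"
  unfolding dilation_def
  by (rule borel_prob_distr) (auto simp: borel_probD measurable_cong_sets[OF borel_probD(3) refl])

lemma borel_prob_convolution [simp]:
  assumes "borel_prob \<mu>" "borel_prob \<nu>"
  shows "borel_prob (\<mu> \<star> \<nu>)"
proof -
  note [measurable_cong] = borel_probD(3)[OF assms(1)] borel_probD(3)[OF assms(2)]
  interpret M: prob_space \<mu> using assms(1) by (rule borel_probD)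
  interpret N: prob_space \<nu> using assms(2) by (rule borel_probD)
  interpret pair_prob_space \<mu> \<nu> ..
  show ?thesis
    unfolding convolution_def by (rule borel_prob_distr) (auto simp: prob_space_axioms)
qed

lemma convolution_comm: "borel_prob \<mu> \<Longrightarrow> borel_prob \<nu> \<Longrightarrow> (\<mu> \<star> \<nu>) = (\<nu> \<star> \<mu>)"
  by (rule convolution_commutative) (auto simp: borel_probD)

lemma convolution_assoc:
  "borel_prob \<mu> \<Longrightarrow> borel_prob \<nu> \<Longrightarrow> borel_prob \<kappa> \<Longrightarrow> ((\<mu> \<star> \<nu>) \<star> \<kappa>) = (\<mu> \<star> (\<nu> \<star> \<kappa>))"
  by (rule convolution_associative[symmetric]) (auto simp: borel_probD)

lemma convolution_left_commute:
  assumes "borel_prob \<mu>" "borel_prob \<nu>" "borel_prob \<kappa>"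
  shows "(\<mu> \<star> (\<nu> \<star> \<kappa>)) = (\<nu> \<star> (\<mu> \<star> \<kappa>))"
  using assms convolution_assoc[of \<mu> \<nu> \<kappa>] convolution_assoc[of \<nu> \<mu> \<kappa>] convolution_comm[of \<mu> \<nu>]
  by simp

lemmas convolution_ac = convolution_assoc convolution_comm convolution_left_commute

lemma convolution_return:
  assumes "borel_prob \<mu>"
  shows "(\<mu> \<star> return borel x) = distr \<mu> borel (\<lambda>y. y + x)"
proof (rule measure_eqI)
  note [measurable_cong] = borel_probD(3)[OF assms]
  fix A assume "A \<in> sets (\<mu> \<star> return borel x)"
  then have [measurable]: "A \<in> sets borel" by simp
  have "emeasure (\<mu> \<star> return borel x) A = (\<integral>\<^sup>+y. indicator A (y + x) \<partial>\<mu>)"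
    using assms by (simp add: convolution_emeasure' borel_probD nn_integral_return)
  also have "\<dots> = (\<integral>\<^sup>+z. indicator A z \<partial>distr \<mu> borel (\<lambda>y. y + x))"
    by (rule nn_integral_distr[symmetric]) auto
  finally show "emeasure (\<mu> \<star> return borel x) A = emeasure (distr \<mu> borel (\<lambda>y. y + x)) A"
    by simp
qed simp

lemma convolution_return_0 [simp]:
  assumes "borel_prob \<mu>"
  shows "(\<mu> \<star> return borel 0) = \<mu>" "(return borel 0 \<star> \<mu>) = \<mu>"
proof -
  show "(\<mu> \<star> return borel 0) = \<mu>"
    using assms by (simp add: convolution_return borel_probD distr_id2)
  then show "(return borel 0 \<star> \<mu>) = \<mu>"
    using assms convolution_comm[of \<mu> "return borel 0"] by simp
qed

lemma dilation_dilation: "borel_prob \<mu> \<Longrightarrow> dilation r (dilation s \<mu>) = dilation (r * s) \<mu>"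
  unfolding dilation_def
  by (subst distr_distr) (auto simp: comp_def measurable_cong_sets[OF borel_probD(3) refl])

lemma dilation_1 [simp]: "borel_prob \<mu> \<Longrightarrow> dilation 1 \<mu> = \<mu>"
  unfolding dilation_def scaleR_one by (simp add: borel_probD distr_id2)

lemma dilation_return [simp]: "dilation r (return borel x) = return borel (r *\<^sub>R x)"
  unfolding dilation_def by (subst distr_return) auto

lemma dilation_distr:
  assumes "f \<in> borel_measurable P"
  shows "dilation r (distr P borel f) = distr P borel (\<lambda>\<omega>. r *\<^sub>R f \<omega>)"
  unfolding dilation_def using assms by (subst distr_distr) (auto simp: comp_def)

lemma dilation_convolution:
  assumes "borel_prob \<mu>" "borel_prob \<nu>"
  shows "dilation r (\<mu> \<star> \<nu>) = (dilation r \<mu> \<star> dilation r \<nu>)"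
proof (rule measure_eqI)
  note [measurable_cong] = borel_probD(3)[OF assms(1)] borel_probD(3)[OF assms(2)]
  interpret N: prob_space \<nu> using assms(2) by (rule borel_probD)
  have sn: "borel_prob (dilation r \<nu>)" "borel_prob (dilation r \<mu>)" using assms by auto
  fix A assume "A \<in> sets (dilation r (\<mu> \<star> \<nu>))"
  then have [measurable]: "A \<in> sets borel" by (simp add: dilation_def)
  have "emeasure (dilation r (\<mu> \<star> \<nu>)) A = (\<integral>\<^sup>+z. indicator A z \<partial>dilation r (\<mu> \<star> \<nu>))"
    by (simp add: dilation_def)
  also have "\<dots> = (\<integral>\<^sup>+z. indicator A (r *\<^sub>R z) \<partial>(\<mu> \<star> \<nu>))"
    unfolding dilation_def by (rule nn_integral_distr) auto
  also have "\<dots> = (\<integral>\<^sup>+x. \<integral>\<^sup>+y. indicator A (r *\<^sub>R x + r *\<^sub>R y) \<partial>\<nu> \<partial>\<mu>)"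
    using assms by (subst nn_integral_convolution) (auto simp: borel_probD scaleR_add_right)
  also have "\<dots> = (\<integral>\<^sup>+x. \<integral>\<^sup>+y. indicator A (r *\<^sub>R x + y) \<partial>dilation r \<nu> \<partial>\<mu>)"
    unfolding dilation_def by (subst nn_integral_distr) auto
  also have "\<dots> = (\<integral>\<^sup>+x. \<integral>\<^sup>+y. indicator A (x + y) \<partial>dilation r \<nu> \<partial>dilation r \<mu>)"
  proof -
    interpret S: prob_space "dilation r \<nu>" using sn by (auto intro: borel_probD)
    note [measurable_cong] = borel_probD(3)[OF sn(1)]
    have "(\<lambda>x. \<integral>\<^sup>+y. indicator A (x + y) \<partial>dilation r \<nu>) \<in> borel_measurable borel" by measurable
    then show ?thesis
      unfolding dilation_def[of r \<mu>] by (subst nn_integral_distr) auto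
  qed
  also have "\<dots> = emeasure (dilation r \<mu> \<star> dilation r \<nu>) A"
    using sn by (simp add: convolution_emeasure' borel_probD)
  finally show "emeasure (dilation r (\<mu> \<star> \<nu>)) A = emeasure (dilation r \<mu> \<star> dilation r \<nu>) A" .
qed (simp add: dilation_def)

lemma borel_prob_conv_power [simp]: "borel_prob \<mu> \<Longrightarrow> borel_prob (conv_power \<mu> n)"
  by (induction n) auto

lemma dilation_conv_power:
  "borel_prob \<mu> \<Longrightarrow> dilation r (conv_power \<mu> n) = conv_power (dilation r \<mu>) n"
  by (induction n) (auto simp: dilation_convolution)

lemma conv_power_convolution:
  "borel_prob \<mu> \<Longrightarrow> borel_prob \<nu> \<Longrightarrow> conv_power (\<mu> \<star> \<nu>) n = (conv_power \<mu> n \<star> conv_power \<nu> n)"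
  by (induction n) (auto simp: convolution_ac)

lemma infinitely_divisible_dilation:
  assumes "infinitely_divisible \<mu>"
  shows "infinitely_divisible (dilation r \<mu>)"
  using assms dilation_conv_power borel_prob_dilation unfolding infinitely_divisible_def by metis

lemma conv_power_return_0 [simp]: "conv_power (return borel 0) n = return borel 0"
  by (induction n) auto

text \<open>The law at time \<open>n\<close> of the recursion that takes \<open>Z\<close> to \<open>r (Z + \<xi>)\<close>, started at \<open>0\<close>, with
  independent innovations \<open>\<xi>\<close> of law \<open>\<nu>\<close>.\<close>

primrec ar_law :: "real \<Rightarrow> (real ^ 'n) measure \<Rightarrow> nat \<Rightarrow> (real ^ 'n) measure" where
  "ar_law r \<nu> 0 = return borel 0"
| "ar_law r \<nu> (Suc n) = dilation r (ar_law r \<nu> n \<star> \<nu>)"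

lemma borel_prob_ar_law [simp]: "borel_prob \<nu> \<Longrightarrow> borel_prob (ar_law r \<nu> n)"
  by (induction n) auto

text \<open>Unrolled, the recursion is a sum of \<open>r ^ k\<close> times the \<open>k\<close>-th
  innovation. As convolution commutes, the new innovation may enter with weight
  \<open>r ^ Suc n\<close> instead of \<open>r\<close>, so the law is also that of a sum that only
  acquires further terms and can therefore converge almost surely.\<close>

lemma ar_law_Suc_right:
  assumes "borel_prob \<nu>"
  shows "ar_law r \<nu> (Suc n) = (ar_law r \<nu> n \<star> dilation (r ^ Suc n) \<nu>)"
proof (induction n)
  case (Suc n)
  have "ar_law r \<nu> (Suc (Suc n)) = (dilation r (ar_law r \<nu> (Suc n)) \<star> dilation r \<nu>)"
    using assms by (simp add: dilation_convolution)
  also have "\<dots> = ((dilation r (ar_law r \<nu> n) \<star> dilation (r ^ Suc (Suc n)) \<nu>) \<star> dilation r \<nu>)"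
    unfolding Suc.IH using assms by (simp add: dilation_convolution dilation_dilation)
  also have "\<dots> = (ar_law r \<nu> (Suc n) \<star> dilation (r ^ Suc (Suc n)) \<nu>)"
    using assms by (simp add: dilation_convolution convolution_ac)
  finally show ?case .
qed (use assms in simp)

text \<open>Dilation and convolution both commute with convolution powers, so a root of the
  innovation law yields a root of every iterate. This feeds the infinite divisibility of the
  limit.\<close>

lemma ar_law_conv_power:
  assumes "borel_prob \<nu>"
  shows "ar_law r (conv_power \<nu> m) n = conv_power (ar_law r \<nu> n) m"
proof (induction n)
  case (Suc n)
  then show ?case
    using assms by (simp add: dilation_convolution conv_power_convolution dilation_conv_power)
qed simp

text \<open>Stationarity: the left side is the law after \<open>n\<close> steps when the recursion
  starts from \<mu> instead of 0. Pulling out the outermost step leaves the induction hypothesis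
  inside one application of the invariant step.\<close>

lemma ar_law_fixed_point:
  assumes "borel_prob \<mu>" "borel_prob \<nu>" "dilation r (\<mu> \<star> \<nu>) = \<mu>"
  shows "(dilation (r ^ n) \<mu> \<star> ar_law r \<nu> n) = \<mu>"
proof (induction n)
  case (Suc n)
  have "(dilation (r ^ Suc n) \<mu> \<star> ar_law r \<nu> (Suc n))
      = dilation r (dilation (r ^ n) \<mu> \<star> (ar_law r \<nu> n \<star> \<nu>))"
    using assms(1,2) by (simp add: dilation_convolution dilation_dilation)
  also have "\<dots> = dilation r ((dilation (r ^ n) \<mu> \<star> ar_law r \<nu> n) \<star> \<nu>)"
    using assms(1,2) by (simp add: convolution_assoc)
  finally show ?case using Suc assms(3) by simp
qed (use assms in simp)

section \<open>Weak convergence tested on bounded Lipschitz functions\<close>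

text \<open>Lipschitz test functions still determine the limit, and they bound the effect of
  perturbing one factor of a convolution uniformly in the other factor. Ordinary weak convergence
  implies this notion.\<close>

definition bl_converges :: "(nat \<Rightarrow> (real ^ 'n) measure) \<Rightarrow> (real ^ 'n) measure \<Rightarrow> bool" where
  "bl_converges \<mu> \<nu> \<longleftrightarrow>
     (\<forall>f :: real ^ 'n \<Rightarrow> real. (\<exists>L. L-lipschitz_on UNIV f) \<and> bounded (range f) \<longrightarrow>
        (\<lambda>n. \<integral>x. f x \<partial>\<mu> n) \<longlonglongrightarrow> (\<integral>x. f x \<partial>\<nu>))"

lemma integrable_bounded_continuous:
  fixes f :: "real ^ 'n \<Rightarrow> real"
  assumes "borel_prob \<mu>" "continuous_on UNIV f" "bounded (range f)"
  shows "integrable \<mu> f"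
proof -
  note [measurable_cong] = borel_probD(3)[OF assms(1)]
  interpret prob_space \<mu> using assms(1) by (rule borel_probD)
  obtain B where "\<And>x. norm (f x) \<le> B" using assms(3) unfolding bounded_iff by auto
  moreover have [measurable]: "f \<in> borel_measurable borel"
    using assms(2) by (rule borel_measurable_continuous_onI)
  ultimately show ?thesis by (intro integrable_const_bound[where B = B]) auto
qed

lemma lipschitz_tent:
  fixes A :: "(real ^ 'n) set"
  assumes "A \<noteq> {}"
  shows "(real k)-lipschitz_on UNIV (\<lambda>x. max 0 (1 - real k * infdist x A))"
proof (rule lipschitz_onI)
  fix x y :: "real ^ 'n"
  have "\<bar>infdist x A - infdist y A\<bar> \<le> dist x y"
    using infdist_triangle[of x A y] infdist_triangle[of y A x] by (simp add: dist_commute)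
  then have "\<bar>real k * infdist x A - real k * infdist y A\<bar> \<le> real k * dist x y"
    by (simp add: abs_mult mult_left_mono flip: right_diff_distrib)
  then show "dist (max 0 (1 - real k * infdist x A)) (max 0 (1 - real k * infdist y A))
      \<le> real k * dist x y"
    by (simp add: dist_real_def)
qed simp

text \<open>Lipschitz tents decrease to the indicator of a closed set, so the two measures agree on
  closed sets, an intersection-stable generator of the Borel sets.\<close>

lemma borel_prob_eqI_lipschitz:
  fixes \<mu> \<nu> :: "(real ^ 'n) measure"
  assumes "borel_prob \<mu>" "borel_prob \<nu>"
    and eq: "\<And>f :: real ^ 'n \<Rightarrow> real. (\<exists>L. L-lipschitz_on UNIV f) \<Longrightarrow> bounded (range f) \<Longrightarrow>
      (\<integral>x. f x \<partial>\<mu>) = (\<integral>x. f x \<partial>\<nu>)"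
  shows "\<mu> = \<nu>"
proof -
  interpret M: prob_space \<mu> using assms(1) by (rule borel_probD)
  interpret N: prob_space \<nu> using assms(2) by (rule borel_probD)
  have tent_lim: "(\<lambda>k. \<integral>x. max 0 (1 - real k * infdist x A) \<partial>\<kappa>) \<longlonglongrightarrow> measure \<kappa> A"
    if \<kappa>: "borel_prob \<kappa>" and A: "closed A" "A \<noteq> {}" for \<kappa> :: "(real ^ 'n) measure" and A
  proof -
    interpret prob_space \<kappa> using \<kappa> by (rule borel_probD)
    note [measurable_cong] = borel_probD(3)[OF \<kappa>]
    have "(\<lambda>k. \<integral>x. max 0 (1 - real k * infdist x A) \<partial>\<kappa>) \<longlonglongrightarrow> (\<integral>x. indicator A x \<partial>\<kappa>)"
    proof (rule integral_dominated_convergence[where w = "\<lambda>_. 1"])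
      show "AE x in \<kappa>. (\<lambda>k. max 0 (1 - real k * infdist x A)) \<longlonglongrightarrow> indicator A x"
      proof (rule AE_I2)
        fix x
        show "(\<lambda>k. max 0 (1 - real k * infdist x A)) \<longlonglongrightarrow> indicator A x"
        proof (cases "x \<in> A")
          case False
          then have "infdist x A > 0"
            using A infdist_pos_not_in_closed by blast
          then have "eventually (\<lambda>k. 1 - real k * infdist x A \<le> 0) sequentially"
            by real_asymp
          then have "eventually (\<lambda>k. max 0 (1 - real k * infdist x A) = 0) sequentially"
            by eventually_elim simp
          then show ?thesis using False by (simp add: tendsto_eventually)
        qed simp
      qed
    next
      show "(indicator A :: _ \<Rightarrow> real) \<in> borel_measurable \<kappa>"
        using A by (simp add: borel_probD[OF \<kappa>] borel_measurable_indicator borel_closed)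
      have [measurable]: "(\<lambda>x. infdist x A) \<in> borel_measurable borel"
        by (intro borel_measurable_continuous_onI continuous_intros)
      show "(\<lambda>x. max 0 (1 - real i * infdist x A)) \<in> borel_measurable \<kappa>" for i
        by measurable
    qed (auto simp: infdist_nonneg)
    then show ?thesis using A by (simp add: borel_probD[OF \<kappa>])
  qed
  \<comment> \<open>The empty set is split off because \<open>infdist x {}\<close> is 0 by
    convention, so that the tents over it would be constantly 1.\<close>
  have closed_eq: "emeasure \<mu> A = emeasure \<nu> A" if A: "closed A" for A
  proof (cases "A = {}")
    case False
    have b: "bounded (range (\<lambda>x. max 0 (1 - real k * infdist x A)))" for k
      by (intro boundedI[of _ 1]) (auto simp: infdist_nonneg)
    have "(\<integral>x. max 0 (1 - real k * infdist x A) \<partial>\<mu>) = (\<integral>x. max 0 (1 - real k * infdist x A) \<partial>\<nu>)" for k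
      by (rule eq) (use lipschitz_tent[OF False] b in auto)
    then have "measure \<mu> A = measure \<nu> A"
      using tent_lim[OF assms(1) A False] tent_lim[OF assms(2) A False] LIMSEQ_unique by auto
    then show ?thesis
      by (simp add: M.emeasure_eq_measure N.emeasure_eq_measure)
  qed simp
  show ?thesis
  proof (rule measure_eqI_generator_eq[where E = "{A. closed A}" and \<Omega> = UNIV and A = "\<lambda>_. UNIV"])
    show "Int_stable {A :: (real ^ 'n) set. closed A}" by (auto simp: Int_stable_def)
    show "sets \<mu> = sigma_sets UNIV {A. closed A}" "sets \<nu> = sigma_sets UNIV {A. closed A}"
      using assms by (simp_all add: borel_probD(3) borel_eq_closed)
  qed (use closed_eq in auto)
qed

lemma bl_converges_unique:
  assumes "bl_converges \<mu> \<nu>" "bl_converges \<mu> \<kappa>" "borel_prob \<nu>" "borel_prob \<kappa>"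
  shows "\<nu> = \<kappa>"
  using assms by (intro borel_prob_eqI_lipschitz) (auto simp: bl_converges_def intro: LIMSEQ_unique)

lemma bl_converges_AE:
  fixes W :: "nat \<Rightarrow> 'a \<Rightarrow> real ^ 'n" and Y :: "'a \<Rightarrow> real ^ 'n"
  assumes "prob_space P" "\<And>n. W n \<in> borel_measurable P" "Y \<in> borel_measurable P"
    and "AE \<omega> in P. (\<lambda>n. W n \<omega>) \<longlonglongrightarrow> Y \<omega>"
  shows "bl_converges (\<lambda>n. distr P borel (W n)) (distr P borel Y)"
    and "weakly_converges (\<lambda>n. distr P borel (W n)) (distr P borel Y) sequentially"
proof -
  interpret prob_space P by fact
  note [measurable] = assms(2,3)
  show *: "weakly_converges (\<lambda>n. distr P borel (W n)) (distr P borel Y) sequentially"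
    unfolding weakly_converges_def
  proof safe
    fix f :: "real ^ 'n \<Rightarrow> real"
    assume f: "continuous_on UNIV f" "bounded (range f)"
    obtain B where B: "\<And>x. norm (f x) \<le> B" using f(2) unfolding bounded_iff by auto
    have [measurable]: "f \<in> borel_measurable borel"
      using f(1) by (rule borel_measurable_continuous_onI)
    have "(\<lambda>n. \<integral>\<omega>. f (W n \<omega>) \<partial>P) \<longlonglongrightarrow> (\<integral>\<omega>. f (Y \<omega>) \<partial>P)"
    proof (rule integral_dominated_convergence[where w = "\<lambda>_. B"])
      show "AE \<omega> in P. (\<lambda>n. f (W n \<omega>)) \<longlonglongrightarrow> f (Y \<omega>)"
        using assms(4)
      proof eventually_elim
        case (elim \<omega>)
        show ?case using continuous_on_tendsto_compose[OF f(1) elim] by simp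
      qed
    qed (use B in auto)
    then show "(\<lambda>n. \<integral>x. f x \<partial>distr P borel (W n)) \<longlonglongrightarrow> (\<integral>x. f x \<partial>distr P borel Y)"
      by (simp add: integral_distr)
  qed
  show "bl_converges (\<lambda>n. distr P borel (W n)) (distr P borel Y)"
    using * lipschitz_on_continuous_on unfolding bl_converges_def weakly_converges_def by blast
qed

lemma lipschitz_on_measurable:
  fixes f :: "real ^ 'n \<Rightarrow> real"
  shows "L-lipschitz_on UNIV f \<Longrightarrow> f \<in> borel_measurable borel"
  by (intro borel_measurable_continuous_onI lipschitz_on_continuous_on)

lemma lipschitz_on_affine:
  fixes f :: "real ^ 'n \<Rightarrow> real"
  assumes "L-lipschitz_on UNIV f"
  shows "(L * \<bar>r\<bar>)-lipschitz_on UNIV (\<lambda>y. f (x + r *\<^sub>R y))"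
proof (rule lipschitz_onI)
  fix y z :: "real ^ 'n"
  have "dist (f (x + r *\<^sub>R y)) (f (x + r *\<^sub>R z)) \<le> L * dist (x + r *\<^sub>R y) (x + r *\<^sub>R z)"
    using assms by (rule lipschitz_onD) auto
  then show "dist (f (x + r *\<^sub>R y)) (f (x + r *\<^sub>R z)) \<le> L * \<bar>r\<bar> * dist y z"
    by (simp add: dist_norm mult.assoc flip: scaleR_diff_right)
qed (use lipschitz_on_nonneg[OF assms] in auto)

lemma bl_converges_dilation:
  fixes \<nu> :: "(real ^ 'n) measure"
  assumes "bl_converges \<mu> \<nu>" "\<And>n. borel_prob (\<mu> n)" "borel_prob \<nu>"
  shows "bl_converges (\<lambda>n. dilation r (\<mu> n)) (dilation r \<nu>)"
  unfolding bl_converges_def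
proof safe
  fix f :: "real ^ 'n \<Rightarrow> real" and L
  assume f: "L-lipschitz_on UNIV f" "bounded (range f)"
  note [measurable] = lipschitz_on_measurable[OF f(1)]
  have *: "(\<integral>x. f x \<partial>dilation r \<kappa>) = (\<integral>x. f (r *\<^sub>R x) \<partial>\<kappa>)" if "borel_prob \<kappa>" for \<kappa>
    unfolding dilation_def
    by (rule integral_distr) (auto simp: measurable_cong_sets[OF borel_probD(3)[OF that] refl])
  have "bounded (range (\<lambda>x. f (r *\<^sub>R x)))" using f(2) by (rule bounded_subset) auto
  then show "(\<lambda>n. \<integral>x. f x \<partial>dilation r (\<mu> n)) \<longlonglongrightarrow> (\<integral>x. f x \<partial>dilation r \<nu>)"
    using assms lipschitz_on_affine[OF f(1), of r 0] unfolding bl_converges_def by (auto simp: *)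
qed

lemma integral_convolution:
  fixes f :: "real ^ 'n \<Rightarrow> 'b :: {banach, second_countable_topology}"
  assumes "borel_prob \<mu>" "borel_prob \<nu>" "f \<in> borel_measurable borel" "\<And>x. norm (f x) \<le> B"
  shows "(\<integral>x. f x \<partial>(\<mu> \<star> \<nu>)) = (\<integral>x. (\<integral>y. f (x + y) \<partial>\<nu>) \<partial>\<mu>)"
proof -
  note [measurable_cong] = borel_probD(3)[OF assms(1)] borel_probD(3)[OF assms(2)]
  note [measurable] = assms(3)
  interpret M: prob_space \<mu> using assms(1) by (rule borel_probD)
  interpret N: prob_space \<nu> using assms(2) by (rule borel_probD)
  interpret pair_prob_space \<mu> \<nu> ..
  have "(\<integral>x. f x \<partial>(\<mu> \<star> \<nu>)) = (\<integral>p. f (fst p + snd p) \<partial>(\<mu> \<Otimes>\<^sub>M \<nu>))"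
    unfolding convolution_def by (subst integral_distr) (auto simp: case_prod_beta)
  also have "\<dots> = (\<integral>x. (\<integral>y. f (x + y) \<partial>\<nu>) \<partial>\<mu>)"
    by (subst integral_fst'[symmetric])
       (auto intro!: integrable_const_bound[where B = B] simp: assms(4))
  finally show ?thesis .
qed

text \<open>The first factor converges through an almost sure representation, so the Lipschitz bound
  absorbs its error uniformly in the second factor.\<close>

lemma bl_converges_convolution:
  fixes W :: "nat \<Rightarrow> 'a \<Rightarrow> real ^ 'n" and Y :: "'a \<Rightarrow> real ^ 'n"
  assumes "prob_space P" "\<And>n. W n \<in> borel_measurable P" "Y \<in> borel_measurable P"
    and AE: "AE \<omega> in P. (\<lambda>n. W n \<omega>) \<longlonglongrightarrow> Y \<omega>"
    and \<beta>: "bl_converges \<beta> \<gamma>" "\<And>n. borel_prob (\<beta> n)" "borel_prob \<gamma>"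
  shows "bl_converges (\<lambda>n. distr P borel (W n) \<star> \<beta> n) (distr P borel Y \<star> \<gamma>)"
  unfolding bl_converges_def
proof safe
  fix f :: "real ^ 'n \<Rightarrow> real" and L
  assume f: "L-lipschitz_on UNIV f" "bounded (range f)"
  interpret prob_space P by fact
  note [measurable] = lipschitz_on_measurable[OF f(1)] assms(2,3)
  obtain B where B: "\<And>x. norm (f x) \<le> B" using f(2) unfolding bounded_iff by auto
  have meas: "(\<lambda>x. \<integral>y. f (x + y) \<partial>\<kappa>) \<in> borel_measurable borel" if "borel_prob \<kappa>" for \<kappa>
  proof -
    interpret K: prob_space \<kappa> using that by (rule borel_probD)
    note [measurable_cong] = borel_probD(3)[OF that]
    show ?thesis by measurable
  qed
  have bound: "norm (\<integral>y. f (x + y) \<partial>\<kappa>) \<le> B" if "borel_prob \<kappa>" for \<kappa> x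
  proof -
    interpret K: prob_space \<kappa> using that by (rule borel_probD)
    have "norm (\<integral>y. f (x + y) \<partial>\<kappa>) \<le> (\<integral>y. norm (f (x + y)) \<partial>\<kappa>)"
      by (rule integral_norm_bound)
    also have "\<dots> \<le> B"
      using B order.trans[OF norm_ge_zero B]
      by (intro K.integral_le_const) (auto intro!: integrable_bounded_continuous[OF that]
          continuous_intros continuous_on_compose2[OF lipschitz_on_continuous_on[OF f(1)]]
          boundedI[where B = B])
    finally show ?thesis .
  qed
  have int: "integrable \<kappa> (\<lambda>y. f (x + y))" if "borel_prob \<kappa>" for x \<kappa>
    using B by (intro integrable_bounded_continuous[OF that])
      (auto intro!: continuous_intros continuous_on_compose2[OF lipschitz_on_continuous_on[OF f(1)]]
          boundedI[where B = B])
  have conv: "(\<integral>x. f x \<partial>(distr P borel V \<star> \<kappa>)) = (\<integral>\<omega>. (\<integral>y. f (V \<omega> + y) \<partial>\<kappa>) \<partial>P)"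
    if [measurable]: "V \<in> borel_measurable P" and \<kappa>: "borel_prob \<kappa>" for V \<kappa>
  proof -
    have "(\<integral>x. f x \<partial>(distr P borel V \<star> \<kappa>)) = (\<integral>x. (\<integral>y. f (x + y) \<partial>\<kappa>) \<partial>distr P borel V)"
      by (rule integral_convolution[OF borel_prob_distr \<kappa> _ B]) (auto simp: prob_space_axioms)
    also have "\<dots> = (\<integral>\<omega>. (\<integral>y. f (V \<omega> + y) \<partial>\<kappa>) \<partial>P)"
      using meas[OF \<kappa>] by (intro integral_distr) auto
    finally show ?thesis .
  qed
  have "(\<lambda>n. \<integral>\<omega>. (\<integral>y. f (W n \<omega> + y) \<partial>\<beta> n) \<partial>P) \<longlonglongrightarrow> (\<integral>\<omega>. (\<integral>y. f (Y \<omega> + y) \<partial>\<gamma>) \<partial>P)"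
  proof (rule integral_dominated_convergence[where w = "\<lambda>_. B"])
    show "(\<lambda>\<omega>. \<integral>y. f (Y \<omega> + y) \<partial>\<gamma>) \<in> borel_measurable P"
      using meas[OF \<beta>(3)] by measurable
    show "(\<lambda>\<omega>. \<integral>y. f (W n \<omega> + y) \<partial>\<beta> n) \<in> borel_measurable P" for n
      using meas[OF \<beta>(2)[of n]] by measurable
    show "AE \<omega> in P. (\<lambda>n. \<integral>y. f (W n \<omega> + y) \<partial>\<beta> n) \<longlonglongrightarrow> (\<integral>y. f (Y \<omega> + y) \<partial>\<gamma>)"
      using AE
    proof eventually_elim
      case (elim \<omega>)
      \<comment> \<open>First the translation moves from \<open>W n \<omega>\<close> to
        \<open>Y \<omega>\<close> under the same law \<open>\<beta> n\<close>; afterwards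
        \<open>\<beta> n\<close> moves to \<gamma> with the translation fixed.\<close>
      have "(\<lambda>n. (\<integral>y. f (W n \<omega> + y) \<partial>\<beta> n) - (\<integral>y. f (Y \<omega> + y) \<partial>\<beta> n)) \<longlonglongrightarrow> 0"
      proof (rule Lim_null_comparison)
        show "(\<lambda>n. L * dist (W n \<omega>) (Y \<omega>)) \<longlonglongrightarrow> 0"
          using elim by (auto intro!: tendsto_mult_right_zero simp: tendsto_dist_iff[symmetric])
        show "eventually (\<lambda>n. norm ((\<integral>y. f (W n \<omega> + y) \<partial>\<beta> n) - (\<integral>y. f (Y \<omega> + y) \<partial>\<beta> n))
            \<le> L * dist (W n \<omega>) (Y \<omega>)) sequentially"
        proof (rule always_eventually, rule allI)
          fix n
          interpret K: prob_space "\<beta> n" using \<beta>(2) by (rule borel_probD)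
          have "norm ((\<integral>y. f (W n \<omega> + y) \<partial>\<beta> n) - (\<integral>y. f (Y \<omega> + y) \<partial>\<beta> n))
              = norm (\<integral>y. f (W n \<omega> + y) - f (Y \<omega> + y) \<partial>\<beta> n)"
            using int[OF \<beta>(2)] by simp
          also have "\<dots> \<le> (\<integral>y. norm (f (W n \<omega> + y) - f (Y \<omega> + y)) \<partial>\<beta> n)"
            by (rule integral_norm_bound)
          also have "\<dots> \<le> L * dist (W n \<omega>) (Y \<omega>)"
          proof (rule K.integral_le_const)
            show "integrable (\<beta> n) (\<lambda>y. norm (f (W n \<omega> + y) - f (Y \<omega> + y)))"
              using int[OF \<beta>(2)] by (intro integrable_norm Bochner_Integration.integrable_diff)
            have "norm (f (W n \<omega> + y) - f (Y \<omega> + y)) \<le> L * dist (W n \<omega>) (Y \<omega>)" for y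
              using lipschitz_onD[OF f(1), of "W n \<omega> + y" "Y \<omega> + y"] by (simp add: dist_norm)
            then show "AE y in \<beta> n. norm (f (W n \<omega> + y) - f (Y \<omega> + y)) \<le> L * dist (W n \<omega>) (Y \<omega>)"
              by simp
          qed
          finally show "norm ((\<integral>y. f (W n \<omega> + y) \<partial>\<beta> n) - (\<integral>y. f (Y \<omega> + y) \<partial>\<beta> n))
            \<le> L * dist (W n \<omega>) (Y \<omega>)" .
        qed
      qed
      moreover have "(\<lambda>n. \<integral>y. f (Y \<omega> + y) \<partial>\<beta> n) \<longlonglongrightarrow> (\<integral>y. f (Y \<omega> + y) \<partial>\<gamma>)"
      proof -
        have "bounded (range (\<lambda>y. f (Y \<omega> + y)))" using f(2) by (rule bounded_subset) auto
        then show ?thesis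
          using \<beta>(1) lipschitz_on_affine[OF f(1), of 1 "Y \<omega>"] unfolding bl_converges_def by auto
      qed
      ultimately show ?case by (auto dest: tendsto_add)
    qed
  qed (use bound \<beta> in auto)
  then show "(\<lambda>n. \<integral>x. f x \<partial>(distr P borel (W n) \<star> \<beta> n)) \<longlonglongrightarrow> (\<integral>x. f x \<partial>(distr P borel Y \<star> \<gamma>))"
    using \<beta> by (simp add: conv)
qed

text \<open>Induction on the exponent. One factor keeps its almost sure representation, while the
  remaining power plays the role of \<open>\<beta> n\<close>, for which convergence in law
  suffices.\<close>

lemma bl_converges_conv_power:
  fixes W :: "nat \<Rightarrow> 'a \<Rightarrow> real ^ 'n" and Y :: "'a \<Rightarrow> real ^ 'n"
  assumes "prob_space P" "\<And>n. W n \<in> borel_measurable P" "Y \<in> borel_measurable P"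
    and "AE \<omega> in P. (\<lambda>n. W n \<omega>) \<longlonglongrightarrow> Y \<omega>"
  shows "bl_converges (\<lambda>n. conv_power (distr P borel (W n)) m) (conv_power (distr P borel Y) m)"
proof (induction m)
  case 0
  show ?case by (simp add: bl_converges_def)
next
  case (Suc m)
  have "borel_prob (distr P borel (W n))" "borel_prob (distr P borel Y)" for n
    using assms by (auto intro: borel_prob_distr)
  then show ?case
    using bl_converges_convolution[OF assms Suc.IH] by simp
qed

section \<open>Characteristic functions and symmetrization\<close>

lemma integrable_char_fun:
  assumes "borel_prob \<mu>"
  shows "integrable \<mu> (\<lambda>x. iexp (z \<bullet> x))"
proof -
  note [measurable_cong] = borel_probD(3)[OF assms]
  interpret prob_space \<mu> using assms by (rule borel_probD)
  show ?thesis by (intro integrable_const_bound[where B = 1]) auto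
qed

lemma char_fun_convolution:
  assumes "borel_prob \<mu>" "borel_prob \<nu>"
  shows "char_fun (\<mu> \<star> \<nu>) z = char_fun \<mu> z * char_fun \<nu> z"
proof -
  have "char_fun (\<mu> \<star> \<nu>) z = (CLINT x|\<mu>. CLINT y|\<nu>. iexp (z \<bullet> (x + y)))"
    unfolding char_fun_def
    by (rule integral_convolution[where B = 1]) (use assms in \<open>auto intro!: borel_measurable_continuous_onI continuous_intros\<close>)
  also have "\<dots> = (CLINT x|\<mu>. iexp (z \<bullet> x) * char_fun \<nu> z)"
    by (simp add: char_fun_def inner_add_right ring_distribs exp_add)
  finally show ?thesis by (simp add: char_fun_def)
qed

lemma char_fun_dilation:
  assumes "borel_prob \<mu>"
  shows "char_fun (dilation r \<mu>) z = char_fun \<mu> (r *\<^sub>R z)"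
proof -
  note [measurable_cong] = borel_probD(3)[OF assms]
  show ?thesis unfolding char_fun_def dilation_def by (subst integral_distr) auto
qed

lemma char_fun_return [simp]: "char_fun (return borel 0) z = 1"
  unfolding char_fun_def by (subst integral_return) auto

lemma cmod_char_fun_le_1:
  assumes "borel_prob \<mu>"
  shows "cmod (char_fun \<mu> z) \<le> 1"
proof -
  interpret prob_space \<mu> using assms by (rule borel_probD)
  have "cmod (char_fun \<mu> z) \<le> (\<integral>x. cmod (iexp (z \<bullet> x)) \<partial>\<mu>)"
    unfolding char_fun_def by (rule integral_norm_bound)
  then show ?thesis by (simp add: prob_space)
qed

lemma char_fun_ar_law:
  assumes "borel_prob \<nu>"
  shows "char_fun (ar_law r \<nu> n) z = (\<Prod>k=1..n. char_fun \<nu> (r ^ k *\<^sub>R z))"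
  using assms
  by (induction n) (simp_all add: ar_law_Suc_right char_fun_convolution char_fun_dilation del: ar_law.simps(2))

text \<open>Every further summand multiplies the characteristic function by a factor of modulus at
  most 1. A lower bound for late \<open>m\<close> thus holds for every earlier
  \<open>n\<close>.\<close>

lemma cmod_char_fun_ar_law_antimono:
  assumes "borel_prob \<nu>" "n \<le> m"
  shows "cmod (char_fun (ar_law r \<nu> m) z) \<le> cmod (char_fun (ar_law r \<nu> n) z)"
  using \<open>n \<le> m\<close>
proof (induction rule: dec_induct)
  case (step k)
  have "cmod (char_fun (ar_law r \<nu> (Suc k)) z)
      = cmod (char_fun (ar_law r \<nu> k) z) * cmod (char_fun \<nu> (r ^ Suc k *\<^sub>R z))"
    using assms(1)
    by (simp add: ar_law_Suc_right char_fun_convolution char_fun_dilation norm_mult del: ar_law.simps(2))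
  also have "\<dots> \<le> cmod (char_fun (ar_law r \<nu> k) z)"
    using cmod_char_fun_le_1[OF assms(1)] by (intro mult_left_le) auto
  finally show ?case using step by simp
qed simp

text \<open>Weak convergence is tested on real functions only, so characteristic functions are
  handled through their cosine and sine parts.\<close>

lemma char_fun_eq_Complex:
  assumes "borel_prob \<mu>"
  shows "char_fun \<mu> z = Complex (\<integral>x. cos (z \<bullet> x) \<partial>\<mu>) (\<integral>x. sin (z \<bullet> x) \<partial>\<mu>)"
proof -
  have "Re (char_fun \<mu> z) = (\<integral>x. Re (iexp (z \<bullet> x)) \<partial>\<mu>)"
       "Im (char_fun \<mu> z) = (\<integral>x. Im (iexp (z \<bullet> x)) \<partial>\<mu>)"
    using integrable_char_fun[OF assms] unfolding char_fun_def by simp_all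
  then show ?thesis by (simp add: complex_eq_iff Re_exp Im_exp)
qed

lemma tendsto_char_fun:
  fixes \<nu> :: "(real ^ 'n) measure"
  assumes "weakly_converges \<mu> \<nu> F" "\<And>i. borel_prob (\<mu> i)" "borel_prob \<nu>"
  shows "((\<lambda>i. char_fun (\<mu> i) z) \<longlongrightarrow> char_fun \<nu> z) F"
proof -
  have "bounded (range (\<lambda>x :: real ^ 'n. cos (z \<bullet> x)))" "bounded (range (\<lambda>x :: real ^ 'n. sin (z \<bullet> x)))"
    by (auto intro!: boundedI[where B = 1])
  moreover have "continuous_on UNIV (\<lambda>x :: real ^ 'n. cos (z \<bullet> x))"
    "continuous_on UNIV (\<lambda>x :: real ^ 'n. sin (z \<bullet> x))"
    by (intro continuous_intros)+
  ultimately have "((\<lambda>i. \<integral>x. cos (z \<bullet> x) \<partial>\<mu> i) \<longlongrightarrow> (\<integral>x. cos (z \<bullet> x) \<partial>\<nu>)) F"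
            "((\<lambda>i. \<integral>x. sin (z \<bullet> x) \<partial>\<mu> i) \<longlongrightarrow> (\<integral>x. sin (z \<bullet> x) \<partial>\<nu>)) F"
    using assms(1)[unfolded weakly_converges_def, rule_format, of "\<lambda>x. cos (z \<bullet> x)"]
      assms(1)[unfolded weakly_converges_def, rule_format, of "\<lambda>x. sin (z \<bullet> x)"]
    by simp_all
  then show ?thesis
    unfolding char_fun_eq_Complex[OF assms(2)] char_fun_eq_Complex[OF assms(3)]
    by (rule tendsto_Complex)
qed

text \<open>Along a ray this is the one-dimensional characteristic function of the projection
  \<open>z \<bullet> x\<close>, which is continuous at 0 with value 1 there.\<close>

lemma tendsto_char_fun_ray_0:
  fixes \<mu> :: "(real ^ 'n) measure"
  assumes "borel_prob \<mu>"
  shows "((\<lambda>u. cmod (char_fun \<mu> (u *\<^sub>R z))) \<longlongrightarrow> 1) (at 0)"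
proof -
  note [measurable_cong] = borel_probD(3)[OF assms]
  interpret prob_space \<mu> using assms by (rule borel_probD)
  interpret D: real_distribution "distr \<mu> borel (\<lambda>x. z \<bullet> x)"
    by (rule real_distribution_distr) auto
  have eq: "char_fun \<mu> (u *\<^sub>R z) = char (distr \<mu> borel (\<lambda>x. z \<bullet> x)) u" for u
    unfolding char_fun_def char_def by (subst integral_distr) auto
  have "((\<lambda>u. cmod (char_fun \<mu> (u *\<^sub>R z))) \<longlongrightarrow> cmod 1) (at 0)"
    unfolding eq using D.isCont_char[of 0] by (intro tendsto_norm) (simp add: isCont_def D.char_zero)
  then show ?thesis by simp
qed

text \<open>The law of the difference of two independent copies. Its characteristic function is the
  squared modulus of that of \<nu>, hence real, so one minus it is an integral of the nonnegative
  function \<open>1 - cos\<close>.\<close>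

definition symmetrization :: "(real ^ 'n) measure \<Rightarrow> (real ^ 'n) measure" where
  "symmetrization \<nu> = (\<nu> \<star> dilation (-1) \<nu>)"

lemma borel_prob_symmetrization [simp]: "borel_prob \<nu> \<Longrightarrow> borel_prob (symmetrization \<nu>)"
  by (simp add: symmetrization_def)

lemma integral_cos_symmetrization:
  assumes "borel_prob \<nu>"
  shows "(\<integral>x. cos (z \<bullet> x) \<partial>symmetrization \<nu>) = (cmod (char_fun \<nu> z))\<^sup>2"
proof -
  have "char_fun \<nu> (- z) = cnj (char_fun \<nu> z)"
    using assms by (simp add: char_fun_eq_Complex complex_eq_iff)
  then have "char_fun (symmetrization \<nu>) z = complex_of_real ((cmod (char_fun \<nu> z))\<^sup>2)"
    using assms
    by (simp add: symmetrization_def char_fun_convolution char_fun_dilation complex_norm_square[symmetric])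
  then show ?thesis
    using assms char_fun_eq_Complex[of "symmetrization \<nu>" z] by (simp add: complex_eq_iff)
qed

section \<open>Tail bounds from characteristic functions\<close>

text \<open>The integral equals \<open>\<delta> - sin (\<delta> * a) / a\<close>, and the subtracted
  term is at most \<open>1 / \<bar>a\<bar>\<close>, which is at most \<open>\<delta> / 2\<close>
  under the assumption on \<open>a\<close>.\<close>

lemma nn_integral_one_minus_cos:
  fixes a \<delta> :: real
  assumes "\<delta> > 0" "2 \<le> \<delta> * \<bar>a\<bar>"
  shows "ennreal (\<delta> / 2) \<le> (\<integral>\<^sup>+u. ennreal (1 - cos (u * a)) * indicator {0..\<delta>} u \<partial>lborel)"
proof -
  have a: "a \<noteq> 0" using assms by auto
  have "(\<integral>\<^sup>+u. ennreal (1 - cos (u * a)) * indicator {0..\<delta>} u \<partial>lborel)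
      = ennreal ((\<delta> - sin (\<delta> * a) / a) - (0 - sin (0 * a) / a))"
    using assms a
    by (intro nn_integral_FTC_Icc) (auto intro!: derivative_eq_intros simp: has_real_derivative_iff_has_vector_derivative[symmetric])
  also have "\<dots> = ennreal (\<delta> - sin (\<delta> * a) / a)" by simp
  also have "\<dots> \<ge> ennreal (\<delta> / 2)"
  proof (rule ennreal_leI)
    have "sin (\<delta> * a) / a \<le> \<bar>sin (\<delta> * a)\<bar> / \<bar>a\<bar>"
      by (metis abs_divide abs_ge_self)
    also have "\<dots> \<le> 1 / \<bar>a\<bar>" by (simp add: divide_right_mono)
    also have "\<dots> \<le> \<delta> / 2" using assms a by (simp add: field_simps)
    finally show "\<delta> / 2 \<le> \<delta> - sin (\<delta> * a) / a" by simp
  qed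
  finally show ?thesis .
qed

text \<open>Averaging over \<open>u\<close> turns the characteristic function bound into a bound on the tails.\<close>

lemma tail_sum_symmetrization:
  fixes \<nu> :: "(real ^ 'n) measure" and w :: "real ^ 'n"
  assumes \<nu>: "borel_prob \<nu>" and "\<delta> > 0"
    and *: "\<And>u. 0 \<le> u \<Longrightarrow> u \<le> \<delta> \<Longrightarrow> (cmod (char_fun (ar_law r \<nu> n) (u *\<^sub>R w)))\<^sup>2 \<ge> 1/2"
  shows "(\<Sum>k=1..n. measure (symmetrization \<nu>) {x. 2 \<le> \<delta> * \<bar>r ^ k * (w \<bullet> x)\<bar>}) \<le> 2 * ln 2"
proof -
  define S where "S = symmetrization \<nu>"
  have S: "borel_prob S" using \<nu> by (simp add: S_def)
  note [measurable_cong] = borel_probD(3)[OF S]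
  interpret S: prob_space S using S by (rule borel_probD)
  interpret pair_sigma_finite S lborel ..
  define p where "p u k = (cmod (char_fun \<nu> (r ^ k *\<^sub>R u *\<^sub>R w)))\<^sup>2" for u k
  \<comment> \<open>Since \<open>p \<le> exp (- (1 - p))\<close> for each factor, the lower bound
    1/2 on the product of the \<open>p u k\<close> becomes the upper bound \<open>ln 2\<close> on
    the sum of their defects.\<close>
  have sum_le: "(\<Sum>k=1..n. 1 - p u k) \<le> ln 2" if "0 \<le> u" "u \<le> \<delta>" for u
  proof -
    have "(cmod (char_fun (ar_law r \<nu> n) (u *\<^sub>R w)))\<^sup>2 = (\<Prod>k=1..n. p u k)"
      using \<nu> by (simp add: char_fun_ar_law p_def prod_norm[symmetric] prod_power_distrib)
    also have "\<dots> \<le> (\<Prod>k=1..n. exp (- (1 - p u k)))"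
    proof (rule prod_mono)
      show "0 \<le> p u k \<and> p u k \<le> exp (- (1 - p u k))" for k
        using exp_ge_add_one_self[of "- (1 - p u k)"] by (simp add: p_def)
    qed
    also have "\<dots> = exp (- (\<Sum>k=1..n. 1 - p u k))"
      by (simp add: exp_sum sum_negf[symmetric])
    finally have "1/2 \<le> exp (- (\<Sum>k=1..n. 1 - p u k))" using *[OF that] by simp
    then have "ln (1/2) \<le> - (\<Sum>k=1..n. 1 - p u k)"
      using ln_le_cancel_iff[of "1/2" "exp (- (\<Sum>k=1..n. 1 - p u k))"] by simp
    then show ?thesis by (simp add: ln_div)
  qed
  have p_int: "ennreal (1 - p u k) = (\<integral>\<^sup>+x. ennreal (1 - cos (u * (r ^ k * (w \<bullet> x)))) \<partial>S)" for u k
  proof -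
    have c: "integrable S (\<lambda>x. cos (u * (r ^ k * (w \<bullet> x))))"
      by (intro S.integrable_const_bound[where B = 1]) auto
    have "(\<integral>x. cos (u * (r ^ k * (w \<bullet> x))) \<partial>S) = p u k"
      using integral_cos_symmetrization[OF \<nu>, of "r ^ k *\<^sub>R u *\<^sub>R w"]
      by (simp add: S_def p_def mult_ac)
    then have "1 - p u k = (\<integral>x. 1 - cos (u * (r ^ k * (w \<bullet> x))) \<partial>S)"
      using c by (simp add: S.prob_space)
    then show ?thesis using c by (simp add: nn_integral_eq_integral)
  qed
  \<comment> \<open>On each tail event the integral of \<open>1 - cos\<close> over \<open>u\<close>
    is at least \<open>\<delta> / 2\<close>. Exchanging the integrals recovers the defects
    \<open>1 - p u k\<close>, whose sum is at most \<open>ln 2\<close> throughout an interval of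
    length \<delta>.\<close>
  have "ennreal (\<delta> / 2 * (\<Sum>k=1..n. measure S {x. 2 \<le> \<delta> * \<bar>r ^ k * (w \<bullet> x)\<bar>}))
      = (\<Sum>k=1..n. \<integral>\<^sup>+x. ennreal (\<delta> / 2) * indicator {x. 2 \<le> \<delta> * \<bar>r ^ k * (w \<bullet> x)\<bar>} x \<partial>S)"
  proof -
    have [measurable]: "{x. 2 \<le> \<delta> * \<bar>r ^ k * (w \<bullet> x)\<bar>} \<in> sets S" for k
    proof -
      have "{x \<in> space S. 2 \<le> \<delta> * \<bar>r ^ k * (w \<bullet> x)\<bar>} \<in> sets S" by measurable
      then show ?thesis by (simp add: borel_probD[OF S])
    qed
    have "(\<integral>\<^sup>+x. ennreal (\<delta> / 2) * indicator {x. 2 \<le> \<delta> * \<bar>r ^ k * (w \<bullet> x)\<bar>} x \<partial>S)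
        = ennreal (\<delta> / 2 * measure S {x. 2 \<le> \<delta> * \<bar>r ^ k * (w \<bullet> x)\<bar>})" for k
    proof -
      have "ennreal (\<delta> / 2) * emeasure S {x. 2 \<le> \<delta> * \<bar>r ^ k * (w \<bullet> x)\<bar>}
          = ennreal (\<delta> / 2 * measure S {x. 2 \<le> \<delta> * \<bar>r ^ k * (w \<bullet> x)\<bar>})"
        unfolding S.emeasure_eq_measure using \<open>\<delta> > 0\<close> by (intro ennreal_mult[symmetric]) auto
      then show ?thesis by (subst nn_integral_cmult_indicator) auto
    qed
    then show ?thesis using \<open>\<delta> > 0\<close> by (simp add: sum_distrib_left)
  qed
  also have "\<dots> \<le> (\<Sum>k=1..n. \<integral>\<^sup>+x. \<integral>\<^sup>+u. ennreal (1 - cos (u * (r ^ k * (w \<bullet> x)))) * indicator {0..\<delta>} u \<partial>lborel \<partial>S)"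
    using nn_integral_one_minus_cos[OF \<open>\<delta> > 0\<close>]
    by (intro sum_mono nn_integral_mono) (auto split: split_indicator)
  also have "\<dots> = (\<Sum>k=1..n. \<integral>\<^sup>+u. ennreal (1 - p u k) * indicator {0..\<delta>} u \<partial>lborel)"
  proof (rule sum.cong[OF refl])
    fix k
    have "(\<integral>\<^sup>+x. \<integral>\<^sup>+u. ennreal (1 - cos (u * (r ^ k * (w \<bullet> x)))) * indicator {0..\<delta>} u \<partial>lborel \<partial>S)
        = (\<integral>\<^sup>+u. \<integral>\<^sup>+x. ennreal (1 - cos (u * (r ^ k * (w \<bullet> x)))) * indicator {0..\<delta>} u \<partial>S \<partial>lborel)"
      by (rule Fubini'[symmetric]) measurable
    also have "\<dots> = (\<integral>\<^sup>+u. ennreal (1 - p u k) * indicator {0..\<delta>} u \<partial>lborel)"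
      by (subst nn_integral_multc) (auto simp: p_int)
    finally show "(\<integral>\<^sup>+x. \<integral>\<^sup>+u. ennreal (1 - cos (u * (r ^ k * (w \<bullet> x)))) * indicator {0..\<delta>} u \<partial>lborel \<partial>S)
      = (\<integral>\<^sup>+u. ennreal (1 - p u k) * indicator {0..\<delta>} u \<partial>lborel)" .
  qed
  also have "\<dots> = (\<integral>\<^sup>+u. (\<Sum>k=1..n. ennreal (1 - p u k) * indicator {0..\<delta>} u) \<partial>lborel)"
  proof (rule nn_integral_sum[symmetric])
    fix k
    have "(\<lambda>u. \<integral>\<^sup>+x. ennreal (1 - cos (u * (r ^ k * (w \<bullet> x)))) \<partial>S) \<in> borel_measurable lborel"
      by measurable
    then show "(\<lambda>u. ennreal (1 - p u k) * indicator {0..\<delta>} u) \<in> borel_measurable lborel"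
      unfolding p_int by measurable
  qed
  also have "\<dots> \<le> (\<integral>\<^sup>+u. ennreal (ln 2) * indicator {0..\<delta>} u \<partial>lborel)"
  proof (intro nn_integral_mono)
    fix u
    have "p u k \<le> 1" for k
      using cmod_char_fun_le_1[OF \<nu>] by (simp add: p_def abs_square_le_1)
    then have "(\<Sum>k=1..n. ennreal (1 - p u k)) = ennreal (\<Sum>k=1..n. 1 - p u k)"
      by (intro sum_ennreal) simp
    then show "(\<Sum>k=1..n. ennreal (1 - p u k) * indicator {0..\<delta>} u) \<le> ennreal (ln 2) * indicator {0..\<delta>} u"
      using sum_le[of u] by (cases "u \<in> {0..\<delta>}") (simp_all add: ennreal_leI)
  qed
  also have "\<dots> = ennreal (\<delta> * ln 2)"
    using \<open>\<delta> > 0\<close> by (subst nn_integral_cmult_indicator) (auto simp: ennreal_mult'' mult.commute)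
  finally have "\<delta> / 2 * (\<Sum>k=1..n. measure S {x. 2 \<le> \<delta> * \<bar>r ^ k * (w \<bullet> x)\<bar>}) \<le> \<delta> * ln 2"
    using \<open>\<delta> > 0\<close> by (subst (asm) ennreal_le_iff) auto
  then show ?thesis using \<open>\<delta> > 0\<close> by (simp add: S_def field_simps)
qed

text \<open>Up to the factor \<open>c\<close> and a bounded error, \<open>V\<close> is the natural
  number \<open>f x\<close>, the integer part of \<open>V x / c\<close>. The integral of
  \<open>f\<close> is the sum over \<open>t\<close> of the measures of \<open>t < f x\<close>, and
  this strict inequality is what produces the level \<open>c * real (Suc t)\<close>. The finite
  measure absorbs the bounded error.\<close>

lemma (in finite_measure) nn_integral_finite_iff_summable_tails:
  fixes V :: "'a \<Rightarrow> real"
  assumes [measurable]: "V \<in> borel_measurable M" and "\<And>x. V x \<ge> 0" "c > 0"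
  shows "(\<integral>\<^sup>+x. ennreal (V x) \<partial>M) < \<infinity> \<longleftrightarrow>
    summable (\<lambda>k. measure M {x \<in> space M. c * real (Suc k) \<le> V x})"
proof -
  define f where "f x = nat \<lfloor>V x / c\<rfloor>" for x
  have [measurable]: "f \<in> M \<rightarrow>\<^sub>M count_space UNIV" unfolding f_def by measurable
  have lt_f: "t < f x \<longleftrightarrow> c * real (Suc t) \<le> V x" for t x
  proof -
    have "t < f x \<longleftrightarrow> int (Suc t) \<le> \<lfloor>V x / c\<rfloor>" unfolding f_def by linarith
    also have "\<dots> \<longleftrightarrow> real (Suc t) \<le> V x / c" by (simp add: le_floor_iff)
    also have "\<dots> \<longleftrightarrow> c * real (Suc t) \<le> V x" using \<open>c > 0\<close> by (simp add: field_simps)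
    finally show ?thesis .
  qed
  have f_real: "real (f x) = of_int \<lfloor>V x / c\<rfloor>" for x
    using assms(2)[of x] \<open>c > 0\<close> by (simp add: f_def)
  have f: "c * real (f x) \<le> V x" "V x \<le> c * real (f x) + c" for x
  proof -
    have "real (f x) \<le> V x / c" "V x / c \<le> real (f x) + 1" unfolding f_real by linarith+
    then show "c * real (f x) \<le> V x" "V x \<le> c * real (f x) + c"
      using \<open>c > 0\<close> by (simp_all add: field_simps)
  qed
  have "(\<integral>\<^sup>+x. ennreal (V x) \<partial>M) < \<infinity> \<longleftrightarrow> (\<integral>\<^sup>+x. of_nat (f x) \<partial>M) < \<infinity>"
  proof
    assume V: "(\<integral>\<^sup>+x. ennreal (V x) \<partial>M) < \<infinity>"
    have "(\<integral>\<^sup>+x. of_nat (f x) \<partial>M) \<le> (\<integral>\<^sup>+x. ennreal (1 / c) * ennreal (V x) \<partial>M)"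
    proof (intro nn_integral_mono)
      fix x
      have "real (f x) \<le> 1 / c * V x" using f(1)[of x] \<open>c > 0\<close> by (simp add: field_simps)
      then show "of_nat (f x) \<le> ennreal (1 / c) * ennreal (V x)"
        using \<open>c > 0\<close> by (simp add: ennreal_leI flip: ennreal_of_nat_eq_real_of_nat ennreal_mult')
    qed
    also have "\<dots> < \<infinity>" using V by (simp add: nn_integral_cmult ennreal_mult_less_top)
    finally show "(\<integral>\<^sup>+x. of_nat (f x) \<partial>M) < \<infinity>" .
  next
    assume V: "(\<integral>\<^sup>+x. of_nat (f x) \<partial>M) < \<infinity>"
    have "(\<integral>\<^sup>+x. ennreal (V x) \<partial>M) \<le> (\<integral>\<^sup>+x. ennreal c * of_nat (f x) + ennreal c \<partial>M)"
    proof (intro nn_integral_mono)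
      fix x
      show "ennreal (V x) \<le> ennreal c * of_nat (f x) + ennreal c"
        using f(2)[of x] \<open>c > 0\<close>
        by (simp add: ennreal_of_nat_eq_real_of_nat ennreal_leI flip: ennreal_mult' ennreal_plus)
    qed
    also have "\<dots> < \<infinity>"
      using V by (simp add: nn_integral_add nn_integral_cmult less_top[symmetric] emeasure_eq_measure ennreal_mult_eq_top_iff)
    finally show "(\<integral>\<^sup>+x. ennreal (V x) \<partial>M) < \<infinity>" .
  qed
  also have "(\<integral>\<^sup>+x. of_nat (f x) \<partial>M) = (\<Sum>t. ennreal (measure M {x \<in> space M. c * real (Suc t) \<le> V x}))"
    by (subst nn_integral_nat_function) (auto simp: lt_f emeasure_eq_measure)
  also have "\<dots> < \<infinity> \<longleftrightarrow> summable (\<lambda>k. measure M {x \<in> space M. c * real (Suc k) \<le> V x})"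
  proof
    assume "(\<Sum>t. ennreal (measure M {x \<in> space M. c * real (Suc t) \<le> V x})) < \<infinity>"
    then show "summable (\<lambda>k. measure M {x \<in> space M. c * real (Suc k) \<le> V x})"
      by (intro summable_suminf_not_top) (auto simp del: of_nat_Suc)
  next
    assume "summable (\<lambda>k. measure M {x \<in> space M. c * real (Suc k) \<le> V x})"
    then have "(\<Sum>t. ennreal (measure M {x \<in> space M. c * real (Suc t) \<le> V x})) \<noteq> top"
      by (rule ennreal_suminf_neq_top) (rule measure_nonneg)
    then show "(\<Sum>t. ennreal (measure M {x \<in> space M. c * real (Suc t) \<le> V x})) < \<infinity>"
      unfolding infinity_ennreal_def by (rule less_top[THEN iffD1])
  qed
  finally show ?thesis .
qed

section \<open>Logarithmic moments\<close>

text \<open>The integrand differs from the positive part of \<open>ln (norm x)\<close> by at most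
  \<open>ln 2\<close>, and unlike that function it is subadditive, which suits convolutions.\<close>

definition log_moment :: "(real ^ 'n) measure \<Rightarrow> ennreal" where
  "log_moment \<mu> = (\<integral>\<^sup>+x. ennreal (ln (1 + norm x)) \<partial>\<mu>)"

lemma ln_1_norm_add_le:
  fixes x y :: "'a :: real_normed_vector"
  shows "ln (1 + norm (x + y)) \<le> ln (1 + norm x) + ln (1 + norm y)"
proof -
  have "1 + norm (x + y) \<le> 1 + (norm x + norm y)" using norm_triangle_ineq[of x y] by simp
  also have "\<dots> \<le> (1 + norm x) * (1 + norm y)" by (simp add: algebra_simps)
  finally have "ln (1 + norm (x + y)) \<le> ln ((1 + norm x) * (1 + norm y))"
    by (subst ln_le_cancel_iff) (auto intro!: mult_pos_pos add_pos_nonneg)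
  then show ?thesis
    by (subst (asm) ln_mult_pos) (auto intro: add_pos_nonneg)
qed

lemma log_moment_finite_iff:
  fixes \<mu> :: "(real ^ 'n) measure"
  assumes "borel_prob \<mu>"
  shows "(\<integral>\<^sup>+x. ennreal (max (ln (norm x)) 0) \<partial>\<mu>) < \<infinity> \<longleftrightarrow> log_moment \<mu> < \<infinity>"
proof
  interpret prob_space \<mu> using assms by (rule borel_probD)
  note [measurable_cong] = borel_probD(3)[OF assms]
  assume *: "(\<integral>\<^sup>+x. ennreal (max (ln (norm x)) 0) \<partial>\<mu>) < \<infinity>"
  have "log_moment \<mu> \<le> (\<integral>\<^sup>+x. ennreal (ln 2) + ennreal (max (ln (norm x)) 0) \<partial>\<mu>)"
    unfolding log_moment_def
  proof (intro nn_integral_mono)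
    fix x :: "real ^ 'n"
    have "ln (1 + norm x) \<le> ln 2 + max (ln (norm x)) 0"
    proof (cases "norm x \<le> 1")
      case True
      then have "ln (1 + norm x) \<le> ln 2" by (subst ln_le_cancel_iff) (auto intro: add_pos_nonneg)
      then show ?thesis by simp
    next
      case False
      then have "ln (1 + norm x) \<le> ln (2 * norm x)"
        by (subst ln_le_cancel_iff) (auto intro: add_pos_nonneg)
      moreover have "x \<noteq> 0" using False by auto
      ultimately show ?thesis using False ln_mult_pos[of 2 "norm x"] by simp
    qed
    from ennreal_leI[OF this]
    show "ennreal (ln (1 + norm x)) \<le> ennreal (ln 2) + ennreal (max (ln (norm x)) 0)"
      by (subst (asm) ennreal_plus) auto
  qed
  also have "\<dots> < \<infinity>" using * by (simp add: nn_integral_add emeasure_space_1)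
  finally show "log_moment \<mu> < \<infinity>" .
next
  assume *: "log_moment \<mu> < \<infinity>"
  have "(\<integral>\<^sup>+x. ennreal (max (ln (norm x)) 0) \<partial>\<mu>) \<le> log_moment \<mu>"
    unfolding log_moment_def
  proof (intro nn_integral_mono ennreal_leI)
    fix x :: "real ^ 'n"
    \<comment> \<open>At the origin the left side vanishes because \<open>ln 0 = 0\<close>;
      elsewhere \<open>ln\<close> is monotone.\<close>
    show "max (ln (norm x)) 0 \<le> ln (1 + norm x)"
      by (cases "x = 0") (auto intro: ln_mono)
  qed
  then show "(\<integral>\<^sup>+x. ennreal (max (ln (norm x)) 0) \<partial>\<mu>) < \<infinity>" using * by simp
qed

lemma log_moment_convolution:
  assumes "borel_prob \<mu>" "borel_prob \<nu>"
  shows "log_moment (\<mu> \<star> \<nu>) \<le> log_moment \<mu> + log_moment \<nu>"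
proof -
  note [measurable_cong] = borel_probD(3)[OF assms(1)] borel_probD(3)[OF assms(2)]
  interpret M: prob_space \<mu> using assms(1) by (rule borel_probD)
  interpret N: prob_space \<nu> using assms(2) by (rule borel_probD)
  have "log_moment (\<mu> \<star> \<nu>) = (\<integral>\<^sup>+x. \<integral>\<^sup>+y. ennreal (ln (1 + norm (x + y))) \<partial>\<nu> \<partial>\<mu>)"
    unfolding log_moment_def using assms by (intro nn_integral_convolution) (auto simp: borel_probD)
  also have "\<dots> \<le> (\<integral>\<^sup>+x. \<integral>\<^sup>+y. ennreal (ln (1 + norm x)) + ennreal (ln (1 + norm y)) \<partial>\<nu> \<partial>\<mu>)"
    using ln_1_norm_add_le by (intro nn_integral_mono) (simp add: ennreal_leI flip: ennreal_plus)
  also have "\<dots> = log_moment \<mu> + log_moment \<nu>"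
    unfolding log_moment_def
    by (simp add: nn_integral_add M.emeasure_space_1 N.emeasure_space_1)
  finally show ?thesis .
qed

text \<open>By Fubini the translate of \<mu> by almost every \<open>y\<close>, hence by some
  \<open>y\<close>, has a finite logarithmic moment, and subadditivity undoes a single translation
  at the cost of the constant \<open>ln (1 + norm y)\<close>. This removes the symmetrization and
  also descends to earlier times of a Levy process.\<close>

lemma log_moment_convolution_left:
  fixes \<mu> :: "(real ^ 'n) measure"
  assumes "borel_prob \<mu>" "borel_prob \<nu>" "log_moment (\<mu> \<star> \<nu>) < \<infinity>"
  shows "log_moment \<mu> < \<infinity>"
proof -
  note [measurable_cong] = borel_probD(3)[OF assms(1)] borel_probD(3)[OF assms(2)]
  interpret M: prob_space \<mu> using assms(1) by (rule borel_probD)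
  interpret N: prob_space \<nu> using assms(2) by (rule borel_probD)
  have "log_moment (\<mu> \<star> \<nu>) = log_moment (\<nu> \<star> \<mu>)" using assms(1,2) by (simp add: convolution_comm)
  also have "\<dots> = (\<integral>\<^sup>+y. \<integral>\<^sup>+x. ennreal (ln (1 + norm (y + x))) \<partial>\<mu> \<partial>\<nu>)"
    unfolding log_moment_def using assms by (intro nn_integral_convolution) (auto simp: borel_probD)
  finally have "(\<integral>\<^sup>+y. \<integral>\<^sup>+x. ennreal (ln (1 + norm (y + x))) \<partial>\<mu> \<partial>\<nu>) \<noteq> \<infinity>"
    using assms(3) by auto
  then have "AE y in \<nu>. (\<integral>\<^sup>+x. ennreal (ln (1 + norm (y + x))) \<partial>\<mu>) \<noteq> \<infinity>"
    by (intro nn_integral_noteq_infinite) auto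
  then have "\<exists>y. (\<integral>\<^sup>+x. ennreal (ln (1 + norm (y + x))) \<partial>\<mu>) \<noteq> \<infinity>"
    by (rule contrapos_pp) simp
  then obtain y where y: "(\<integral>\<^sup>+x. ennreal (ln (1 + norm (y + x))) \<partial>\<mu>) \<noteq> \<infinity>" ..
  have "log_moment \<mu> \<le> (\<integral>\<^sup>+x. ennreal (ln (1 + norm (y + x))) + ennreal (ln (1 + norm y)) \<partial>\<mu>)"
    unfolding log_moment_def
  proof (intro nn_integral_mono)
    fix x :: "real ^ 'n"
    have "ln (1 + norm x) \<le> ln (1 + norm (y + x)) + ln (1 + norm y)"
      using ln_1_norm_add_le[of "y + x" "- y"] by simp
    then show "ennreal (ln (1 + norm x)) \<le> ennreal (ln (1 + norm (y + x))) + ennreal (ln (1 + norm y))"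
      by (simp add: ennreal_leI flip: ennreal_plus)
  qed
  also have "\<dots> < \<infinity>" using y by (simp add: nn_integral_add M.emeasure_space_1 less_top[symmetric])
  finally show ?thesis .
qed

lemma log_moment_conv_power:
  fixes \<mu> :: "(real ^ 'n) measure"
  assumes "borel_prob \<mu>" "log_moment \<mu> < \<infinity>"
  shows "log_moment (conv_power \<mu> n) < \<infinity>"
proof (induction n)
  case 0
  have "log_moment (return borel (0 :: real ^ 'n)) = 0"
    unfolding log_moment_def by (subst nn_integral_return) auto
  then show ?case by simp
next
  case (Suc n)
  have "log_moment (conv_power \<mu> (Suc n)) \<le> log_moment \<mu> + log_moment (conv_power \<mu> n)"
    using assms by (simp add: log_moment_convolution)
  also have "\<dots> < \<infinity>" using Suc assms by simp
  finally show ?case .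
qed

text \<open>The norm is at most the sum of the absolute coordinates, over which
  \<open>ln (1 + t)\<close> is subadditive. Tails therefore need to be controlled on one axis at a
  time.\<close>

lemma log_moment_finite_of_coordinates:
  fixes \<mu> :: "(real ^ 'n) measure"
  assumes "borel_prob \<mu>"
    and "\<And>i. (\<integral>\<^sup>+x. ennreal (ln (1 + \<bar>x $ i\<bar>)) \<partial>\<mu>) < \<infinity>"
  shows "log_moment \<mu> < \<infinity>"
proof -
  note [measurable_cong] = borel_probD(3)[OF assms(1)]
  have sub: "ln (1 + (\<Sum>i\<in>A. \<bar>x $ i\<bar>)) \<le> (\<Sum>i\<in>A. ln (1 + \<bar>x $ i\<bar>))" if "finite A" for A and x :: "real ^ 'n"
    using that
  proof (induction A)
    case (insert a A)
    have "ln (1 + \<bar>\<bar>x $ a\<bar> + (\<Sum>i\<in>A. \<bar>x $ i\<bar>)\<bar>) \<le> ln (1 + \<bar>x $ a\<bar>) + ln (1 + (\<Sum>i\<in>A. \<bar>x $ i\<bar>))"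
      using ln_1_norm_add_le[of "\<bar>x $ a\<bar>" "\<Sum>i\<in>A. \<bar>x $ i\<bar>"] by (simp add: sum_nonneg)
    then show ?case using insert by (simp add: sum_nonneg)
  qed simp
  have "log_moment \<mu> \<le> (\<integral>\<^sup>+x. (\<Sum>i\<in>UNIV. ennreal (ln (1 + \<bar>x $ i\<bar>))) \<partial>\<mu>)"
    unfolding log_moment_def
  proof (intro nn_integral_mono)
    fix x :: "real ^ 'n"
    have "ln (1 + norm x) \<le> ln (1 + (\<Sum>i\<in>UNIV. \<bar>x $ i\<bar>))"
      using norm_le_l1_cart[of x] by (intro ln_mono) (auto intro: add_pos_nonneg)
    also have "\<dots> \<le> (\<Sum>i\<in>UNIV. ln (1 + \<bar>x $ i\<bar>))" by (rule sub) simp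
    finally show "ennreal (ln (1 + norm x)) \<le> (\<Sum>i\<in>UNIV. ennreal (ln (1 + \<bar>x $ i\<bar>)))"
      by (simp add: sum_ennreal ennreal_leI)
  qed
  also have "\<dots> = (\<Sum>i\<in>UNIV. \<integral>\<^sup>+x. ennreal (ln (1 + \<bar>x $ i\<bar>)) \<partial>\<mu>)"
    by (rule nn_integral_sum) auto
  also have "\<dots> < \<infinity>" using assms(2) by (simp add: less_top[symmetric])
  finally show ?thesis .
qed

text \<open>Continuity at 0 keeps the squared modulus of \<open>char_fun \<mu>\<close> above 1/2
  near 0 on each axis, and by domination this passes to all iterates with the same \<delta>. The
  tail sums of the symmetrization at the geometric levels are then bounded independently of
  \<open>n\<close>, which is a logarithmic moment in each coordinate.\<close>

lemma log_moment_finite_of_char_fun_bound: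
  fixes \<nu> :: "(real ^ 'n) measure"
  assumes \<nu>: "borel_prob \<nu>" and "b > 1" and \<mu>: "borel_prob \<mu>"
    and le: "\<And>z n. cmod (char_fun \<mu> z) \<le> cmod (char_fun (ar_law (inverse b) \<nu> n) z)"
  shows "log_moment \<nu> < \<infinity>"
proof -
  define S where "S = symmetrization \<nu>"
  have S: "borel_prob S" using \<nu> by (simp add: S_def)
  note [measurable_cong] = borel_probD(3)[OF S]
  interpret S: prob_space S using S by (rule borel_probD)
  have "(\<integral>\<^sup>+x. ennreal (ln (1 + \<bar>x $ i\<bar>)) \<partial>S) < \<infinity>" for i
  proof -
    define w :: "real ^ 'n" where "w = axis i 1"
    have w: "w \<bullet> x = x $ i" for x unfolding w_def by (simp add: inner_axis')
    have "((\<lambda>u. (cmod (char_fun \<mu> (u *\<^sub>R w)))\<^sup>2) \<longlongrightarrow> 1\<^sup>2) (at 0)"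
      by (intro tendsto_intros tendsto_char_fun_ray_0[OF \<mu>])
    then have "eventually (\<lambda>u. (cmod (char_fun \<mu> (u *\<^sub>R w)))\<^sup>2 > 1/2) (at 0)"
      by (rule order_tendstoD) simp
    then obtain d where d: "d > 0" "\<And>u. u \<noteq> 0 \<Longrightarrow> \<bar>u\<bar> < d \<Longrightarrow> (cmod (char_fun \<mu> (u *\<^sub>R w)))\<^sup>2 > 1/2"
      unfolding eventually_at by auto
    \<comment> \<open>Halving \<open>d\<close> keeps the closed interval up to \<delta> inside the
      open ball. The limit at 0 gives no information at \<open>u = 0\<close> itself, where the
      characteristic function is 1 by direct computation.\<close>
    define \<delta> where "\<delta> = d / 2"
    have \<delta>: "\<delta> > 0" using d by (simp add: \<delta>_def)
    have half: "(cmod (char_fun (ar_law (inverse b) \<nu> n) (u *\<^sub>R w)))\<^sup>2 \<ge> 1/2" if "0 \<le> u" "u \<le> \<delta>" for u n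
    proof (cases "u = 0")
      case True
      then show ?thesis
        using \<nu> prob_space.prob_space[OF borel_probD(1), of "ar_law (inverse b) \<nu> n"]
        by (simp add: char_fun_def)
    next
      case False
      then have "1/2 \<le> (cmod (char_fun \<mu> (u *\<^sub>R w)))\<^sup>2"
        using d that by (intro less_imp_le d) (auto simp: \<delta>_def)
      also have "\<dots> \<le> (cmod (char_fun (ar_law (inverse b) \<nu> n) (u *\<^sub>R w)))\<^sup>2"
        using le by (intro power_mono) auto
      finally show ?thesis .
    qed
    \<comment> \<open>\<open>V\<close> is the logarithm of the coordinate measured in units of
      \<open>2 / \<delta>\<close>, cut off at 0. Its tails at the positive multiples of
      \<open>ln b\<close> are exactly the events of \<open>tail_sum_symmetrization\<close>.\<close>
    define V where "V x = max 0 (ln (\<delta> / 2 * \<bar>x $ i\<bar>))" for x :: "real ^ 'n"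
    have [measurable]: "V \<in> borel_measurable S" unfolding V_def by measurable
    have V_iff: "ln b * real (Suc k) \<le> V x \<longleftrightarrow> 2 \<le> \<delta> * \<bar>inverse b ^ Suc k * (w \<bullet> x)\<bar>" for k x
    proof -
      have lb: "ln b > 0" using \<open>b > 1\<close> by simp
      have "ln b * real (Suc k) \<le> V x \<longleftrightarrow> ln (b ^ Suc k) \<le> ln (\<delta> / 2 * \<bar>x $ i\<bar>)"
      proof -
        have "ln b * real (Suc k) > 0" using lb by simp
        then have "ln b * real (Suc k) \<le> V x \<longleftrightarrow> ln b * real (Suc k) \<le> ln (\<delta> / 2 * \<bar>x $ i\<bar>)"
          unfolding V_def by linarith
        moreover have "ln (b ^ Suc k) = ln b * real (Suc k)"
          using \<open>b > 1\<close> by (subst ln_realpow) (auto simp: mult.commute)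
        ultimately show ?thesis by simp
      qed
      \<comment> \<open>At \<open>x $ i = 0\<close> monotonicity of \<open>ln\<close> does not
        apply; there \<open>ln 0 = 0\<close> is smaller than \<open>ln (b ^ Suc k)\<close>, and both
        sides are false.\<close>
      also have "\<dots> \<longleftrightarrow> b ^ Suc k \<le> \<delta> / 2 * \<bar>x $ i\<bar>"
      proof (cases "x $ i = 0")
        case True
        have "ln (b ^ Suc k) > 0" using \<open>b > 1\<close> by (intro ln_gt_zero one_less_power) auto
        moreover have "b ^ Suc k > 0" using \<open>b > 1\<close> by simp
        ultimately show ?thesis using True by (simp add: not_le del: power_Suc)
      next
        case False
        then show ?thesis using \<delta> \<open>b > 1\<close> by (intro ln_le_cancel_iff) auto
      qed
      also have "\<dots> \<longleftrightarrow> 2 \<le> \<delta> * \<bar>inverse b ^ Suc k * (w \<bullet> x)\<bar>"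
        using \<open>b > 1\<close> by (simp add: w abs_mult power_abs power_inverse field_simps del: power_Suc)
      finally show ?thesis .
    qed
    have "summable (\<lambda>k. measure S {x \<in> space S. ln b * real (Suc k) \<le> V x})"
    proof (rule summableI_nonneg_bounded)
      fix n
      have "(\<Sum>k<n. measure S {x \<in> space S. ln b * real (Suc k) \<le> V x})
          = (\<Sum>k=1..n. measure S {x. 2 \<le> \<delta> * \<bar>inverse b ^ k * (w \<bullet> x)\<bar>})"
        unfolding V_iff by (simp add: borel_probD[OF S] sum.atLeast1_atMost_eq)
      also have "\<dots> \<le> 2 * ln 2"
        unfolding S_def by (rule tail_sum_symmetrization[OF \<nu> \<delta> half])
      finally show "(\<Sum>k<n. measure S {x \<in> space S. ln b * real (Suc k) \<le> V x}) \<le> 2 * ln 2" .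
    qed simp
    then have V: "(\<integral>\<^sup>+x. ennreal (V x) \<partial>S) < \<infinity>"
      using \<open>b > 1\<close> by (subst S.nn_integral_finite_iff_summable_tails[where c = "ln b"]) (auto simp: V_def)
    \<comment> \<open>\<open>C\<close> covers the coordinates up to \<open>2 / \<delta>\<close>. For
      a larger value \<open>t\<close>, the inequality \<open>1 < \<delta> / 2 * t\<close> gives
      \<open>1 + t \<le> (1 + 2 / \<delta>) * (\<delta> / 2 * t)\<close>, whose logarithm is
      \<open>C\<close> plus the uncut part of \<open>V\<close>.\<close>
    define C where "C = ln (1 + 2 / \<delta>)"
    have C: "C \<ge> 0" using \<delta> by (simp add: C_def)
    have "(\<integral>\<^sup>+x. ennreal (ln (1 + \<bar>x $ i\<bar>)) \<partial>S) \<le> (\<integral>\<^sup>+x. ennreal C + ennreal (V x) \<partial>S)"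
    proof (intro nn_integral_mono)
      fix x :: "real ^ 'n"
      have "ln (1 + \<bar>x $ i\<bar>) \<le> C + V x"
      proof (cases "\<delta> / 2 * \<bar>x $ i\<bar> \<le> 1")
        case True
        then have "\<bar>x $ i\<bar> \<le> 2 / \<delta>" using \<delta> by (simp add: field_simps)
        then have "ln (1 + \<bar>x $ i\<bar>) \<le> C" unfolding C_def using \<delta> by (intro ln_mono) auto
        then show ?thesis by (simp add: V_def)
      next
        case False
        then have pos: "\<delta> / 2 * \<bar>x $ i\<bar> > 1" by simp
        have "1 + \<bar>x $ i\<bar> \<le> \<delta> / 2 * \<bar>x $ i\<bar> + \<bar>x $ i\<bar>" using pos by simp
        also have "\<dots> = (1 + 2 / \<delta>) * (\<delta> / 2 * \<bar>x $ i\<bar>)" using \<delta> by (simp add: field_simps)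
        finally have "ln (1 + \<bar>x $ i\<bar>) \<le> ln ((1 + 2 / \<delta>) * (\<delta> / 2 * \<bar>x $ i\<bar>))"
          by (intro ln_mono) auto
        also have "\<dots> = C + ln (\<delta> / 2 * \<bar>x $ i\<bar>)"
          unfolding C_def using \<delta> pos by (intro ln_mult_pos) (auto intro: add_pos_pos)
        finally show ?thesis by (simp add: V_def)
      qed
      moreover have "V x \<ge> 0" by (simp add: V_def)
      ultimately show "ennreal (ln (1 + \<bar>x $ i\<bar>)) \<le> ennreal C + ennreal (V x)"
        using C by (simp add: ennreal_leI flip: ennreal_plus)
    qed
    also have "\<dots> < \<infinity>"
      using V by (subst nn_integral_add) (auto simp: V_def S.emeasure_space_1 less_top[symmetric])
    finally show ?thesis .
  qed
  then have "log_moment (\<nu> \<star> dilation (-1) \<nu>) < \<infinity>"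
    using log_moment_finite_of_coordinates[OF S] by (simp add: S_def symmetrization_def)
  then show ?thesis using \<nu> by (intro log_moment_convolution_left[of \<nu> "dilation (-1) \<nu>"]) auto
qed

section \<open>Levy processes\<close>

text \<open>The sum over \<open>I\<close> and the extra summand are functions of disjoint blocks of
  an independent family, hence independent of each other, so their laws convolve.\<close>

lemma (in prob_space) distr_sum_indep_insert:
  fixes Y :: "'i \<Rightarrow> 'a \<Rightarrow> real ^ 'n"
  assumes I: "finite I" "i \<notin> I" and indep: "indep_vars (\<lambda>_. borel) Y (insert i I)"
  shows "distr M borel (\<lambda>\<omega>. (\<Sum>j\<in>I. a j *\<^sub>R Y j \<omega>) + a i *\<^sub>R Y i \<omega>)
      = (distr M borel (\<lambda>\<omega>. \<Sum>j\<in>I. a j *\<^sub>R Y j \<omega>) \<star> dilation (a i) (distr M borel (Y i)))"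
proof -
  have rv [measurable]: "j \<in> insert i I \<Longrightarrow> Y j \<in> borel_measurable M" for j
    using indep unfolding indep_vars_def by auto
  have "indep_var
    borel ((\<lambda>f. \<Sum>j\<in>I. a j *\<^sub>R f j) \<circ> (\<lambda>\<omega>. restrict (\<lambda>i. Y i \<omega>) I))
    borel ((\<lambda>f. a i *\<^sub>R f i) \<circ> (\<lambda>\<omega>. restrict (\<lambda>i. Y i \<omega>) {i}))"
    using I by (intro indep_var_compose[OF indep_var_restrict[OF indep]]) auto
  also have "((\<lambda>f. a i *\<^sub>R f i) \<circ> (\<lambda>\<omega>. restrict (\<lambda>i. Y i \<omega>) {i})) = (\<lambda>\<omega>. a i *\<^sub>R Y i \<omega>)"
    by auto
  also have "((\<lambda>f. \<Sum>j\<in>I. a j *\<^sub>R f j) \<circ> (\<lambda>\<omega>. restrict (\<lambda>i. Y i \<omega>) I)) = (\<lambda>\<omega>. \<Sum>j\<in>I. a j *\<^sub>R Y j \<omega>)"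
    by (auto cong: rev_conj_cong)
  finally have ind: "indep_var borel (\<lambda>\<omega>. \<Sum>j\<in>I. a j *\<^sub>R Y j \<omega>) borel (\<lambda>\<omega>. a i *\<^sub>R Y i \<omega>)" .
  have "distr M borel (\<lambda>\<omega>. (\<Sum>j\<in>I. a j *\<^sub>R Y j \<omega>) + a i *\<^sub>R Y i \<omega>)
      = (distr M borel (\<lambda>\<omega>. \<Sum>j\<in>I. a j *\<^sub>R Y j \<omega>) \<star> distr M borel (\<lambda>\<omega>. a i *\<^sub>R Y i \<omega>))"
    by (rule sum_indep_random_variable[OF ind])
       (auto intro!: borel_measurable_sum borel_measurable_scaleR)
  then show ?thesis by (simp add: dilation_distr)
qed

lemma (in prob_space) tendsto_in_prob_AE:
  fixes W :: "nat \<Rightarrow> 'a \<Rightarrow> real ^ 'n" and Y :: "'a \<Rightarrow> real ^ 'n"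
  assumes [measurable]: "\<And>n. W n \<in> borel_measurable M" "Y \<in> borel_measurable M"
    and AE: "AE \<omega> in M. (\<lambda>n. W n \<omega>) \<longlonglongrightarrow> Y \<omega>"
  shows "tendsto_in_prob M W Y sequentially"
  unfolding tendsto_in_prob_def
proof safe
  fix \<epsilon> :: real assume "\<epsilon> > 0"
  define A where "A n = {\<omega> \<in> space M. norm (W n \<omega> - Y \<omega>) > \<epsilon>}" for n
  have [measurable]: "A n \<in> sets M" for n unfolding A_def by measurable
  have "(\<lambda>n. \<integral>\<omega>. indicator (A n) \<omega> \<partial>M :: real) \<longlonglongrightarrow> (\<integral>\<omega>. 0 \<partial>M)"
  proof (rule integral_dominated_convergence[where w = "\<lambda>_. 1"])
    show "AE \<omega> in M. (\<lambda>n. indicator (A n) \<omega> :: real) \<longlonglongrightarrow> 0"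
      using AE
    proof eventually_elim
      case (elim \<omega>)
      have "eventually (\<lambda>n. dist (W n \<omega>) (Y \<omega>) < \<epsilon>) sequentially"
        using elim \<open>\<epsilon> > 0\<close> by (rule tendstoD)
      then have "eventually (\<lambda>n. (indicator (A n) \<omega> :: real) = 0) sequentially"
        by eventually_elim (simp add: A_def dist_norm indicator_def)
      then show ?case by (rule tendsto_eventually)
    qed
  qed auto
  then show "(\<lambda>n. measure M {\<omega> \<in> space M. norm (W n \<omega> - Y \<omega>) > \<epsilon>}) \<longlonglongrightarrow> 0"
    by (simp add: A_def)
qed

lemma filterlim_nat_floor_at_top:
  fixes c :: real
  assumes "c > 0"
  shows "filterlim (\<lambda>t. nat \<lfloor>c * t\<rfloor>) at_top at_top"
  unfolding filterlim_at_top
proof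
  fix Z :: nat
  have "eventually (\<lambda>t. real Z / c \<le> t) at_top" by (rule eventually_ge_at_top)
  then show "eventually (\<lambda>t. Z \<le> nat \<lfloor>c * t\<rfloor>) at_top"
  proof eventually_elim
    case (elim t)
    then have "real Z \<le> c * t" using assms by (simp add: field_simps)
    then show ?case by linarith
  qed
qed

text \<open>The laws in continuous time are those of a sequence, held constant between grid points.
  Sampling at \<open>real n / c\<close> gives one direction, composing with the floor, which tends
  to infinity, the other.\<close>

lemma weakly_converges_floor_iff:
  fixes c :: real and \<kappa> :: "(real ^ 'd) measure"
  assumes "c > 0" and eq: "\<And>t. t \<ge> 0 \<Longrightarrow> \<mu> t = \<nu> (nat \<lfloor>c * t\<rfloor>)"
  shows "weakly_converges \<mu> \<kappa> at_top \<longleftrightarrow> weakly_converges \<nu> \<kappa> sequentially"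
proof
  assume \<mu>: "weakly_converges \<mu> \<kappa> at_top"
  have lim: "filterlim (\<lambda>n. real n / c) at_top sequentially"
    using assms(1) by real_asymp
  have \<mu>_grid: "\<mu> (real n / c) = \<nu> n" for n using eq[of "real n / c"] assms(1) by simp
  show "weakly_converges \<nu> \<kappa> sequentially"
    unfolding weakly_converges_def
  proof (intro allI impI)
    fix f :: "real ^ 'd \<Rightarrow> real"
    assume "continuous_on UNIV f \<and> bounded (range f)"
    then have "((\<lambda>t. \<integral>x. f x \<partial>\<mu> t) \<longlongrightarrow> (\<integral>x. f x \<partial>\<kappa>)) at_top"
      using \<mu> unfolding weakly_converges_def by blast
    from filterlim_compose[OF this lim]
    show "(\<lambda>n. \<integral>x. f x \<partial>\<nu> n) \<longlonglongrightarrow> (\<integral>x. f x \<partial>\<kappa>)" by (simp add: \<mu>_grid)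
  qed
next
  assume \<nu>: "weakly_converges \<nu> \<kappa> sequentially"
  show "weakly_converges \<mu> \<kappa> at_top"
    unfolding weakly_converges_def
  proof (intro allI impI)
    fix f :: "real ^ 'd \<Rightarrow> real"
    assume "continuous_on UNIV f \<and> bounded (range f)"
    then have "(\<lambda>n. \<integral>x. f x \<partial>\<nu> n) \<longlonglongrightarrow> (\<integral>x. f x \<partial>\<kappa>)"
      using \<nu> unfolding weakly_converges_def by blast
    then have "((\<lambda>t. \<integral>x. f x \<partial>\<nu> (nat \<lfloor>c * t\<rfloor>)) \<longlongrightarrow> (\<integral>x. f x \<partial>\<kappa>)) at_top"
      by (rule filterlim_compose[OF _ filterlim_nat_floor_at_top[OF assms(1)]])
    moreover have "eventually (\<lambda>t. (\<integral>x. f x \<partial>\<nu> (nat \<lfloor>c * t\<rfloor>)) = (\<integral>x. f x \<partial>\<mu> t)) at_top"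
      using eventually_ge_at_top[of 0] by eventually_elim (simp add: eq)
    ultimately show "((\<lambda>t. \<integral>x. f x \<partial>\<mu> t) \<longlongrightarrow> (\<integral>x. f x \<partial>\<kappa>)) at_top"
      by (rule Lim_transform_eventually)
  qed
qed

section \<open>Laws of a Levy process at fixed times\<close>

locale levy =
  fixes P :: "'a measure" and X :: "real \<Rightarrow> 'a \<Rightarrow> real ^ 'n"
  assumes levy_process: "levy_process P X"
begin

sublocale prob_space P
  using levy_process unfolding levy_process_def by blast

lemma measurable_X [measurable]: "0 \<le> t \<Longrightarrow> X t \<in> borel_measurable P"
  using levy_process unfolding levy_process_def by blast

lemma AE_X_0: "AE \<omega> in P. X 0 \<omega> = 0"
  using levy_process unfolding levy_process_def by blast

definition law :: "real \<Rightarrow> (real ^ 'n) measure" where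
  "law t = distr P borel (X t)"

lemma borel_prob_law [simp]: "0 \<le> t \<Longrightarrow> borel_prob (law t)"
  unfolding law_def by (rule borel_prob_distr) (auto simp: prob_space_axioms)

lemma law_0 [simp]: "law 0 = return borel 0"
proof -
  have "law 0 = distr P borel (\<lambda>_. 0)"
    unfolding law_def using AE_X_0 by (intro distr_cong_AE) auto
  then show ?thesis by simp
qed

text \<open>Stationarity compares with \<open>X u - X 0\<close>, and \<open>X 0\<close> vanishes
  almost surely, which suffices for equality of laws.\<close>

lemma law_increment:
  assumes "0 \<le> s" "s \<le> t"
  shows "distr P borel (\<lambda>\<omega>. X t \<omega> - X s \<omega>) = law (t - s)"
proof -
  have st: "distr P borel (\<lambda>\<omega>. X (s + u) \<omega> - X s \<omega>) = distr P borel (\<lambda>\<omega>. X u \<omega> - X 0 \<omega>)"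
    if "u \<ge> 0" for u
    using levy_process that assms(1) unfolding levy_process_def by blast
  have "distr P borel (\<lambda>\<omega>. X (t - s) \<omega> - X 0 \<omega>) = law (t - s)"
    unfolding law_def
  proof (rule distr_cong_AE)
    show "AE \<omega> in P. X (t - s) \<omega> - X 0 \<omega> = X (t - s) \<omega>"
      using AE_X_0 by eventually_elim simp
  qed (use assms in auto)
  then show ?thesis using st[of "t - s"] assms by simp
qed

lemma indep_vars_increments:
  assumes "0 \<le> t 0" "\<And>i. i < n \<Longrightarrow> t i < t (Suc i)"
  shows "indep_vars (\<lambda>_. borel)
    (\<lambda>i \<omega>. if i = 0 then X (t 0) \<omega> else X (t i) \<omega> - X (t (i - 1)) \<omega>) {..n}"
  using levy_process assms unfolding levy_process_def by blast

lemma law_add: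
  assumes "0 \<le> s" "0 \<le> t"
  shows "law (s + t) = (law s \<star> law t)"
proof (cases "t = 0")
  case True
  then show ?thesis using assms by simp
next
  case False
  \<comment> \<open>Independence of increments is stated for strictly increasing times, which is why
    \<open>t = 0\<close> has been split off. The first member of the family is \<open>X s\<close>
    itself.\<close>
  define u where "u i = s + real i * t" for i
  define D where "D i \<omega> = (if i = 0 then X (u 0) \<omega> else X (u i) \<omega> - X (u (i - 1)) \<omega>)" for i \<omega>
  have "indep_vars (\<lambda>_. borel) (\<lambda>i \<omega>. D i \<omega>) {..1}"
    unfolding D_def by (rule indep_vars_increments) (use assms False in \<open>auto simp: u_def algebra_simps\<close>)
  then have "indep_vars (\<lambda>_. borel) D (insert 1 {0})" by (simp add: atMost_Suc insert_commute)
  from distr_sum_indep_insert[OF _ _ this, of "\<lambda>_. 1"]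
  have "distr P borel (\<lambda>\<omega>. D 0 \<omega> + D 1 \<omega>) = (distr P borel (D 0) \<star> dilation 1 (distr P borel (D 1)))"
    by simp
  moreover have "(\<lambda>\<omega>. D 0 \<omega> + D 1 \<omega>) = X (s + t)" "D 0 = X s" "D 1 = (\<lambda>\<omega>. X (s + t) \<omega> - X s \<omega>)"
    by (auto simp: D_def u_def)
  ultimately show ?thesis
    using assms law_increment[of s "s + t"] by (simp add: law_def borel_prob_law[unfolded law_def])
qed

lemma conv_power_law: "0 \<le> t \<Longrightarrow> conv_power (law t) n = law (real n * t)"
proof (induction n)
  case (Suc n)
  then show ?case using law_add[of t "real n * t"] by (simp add: algebra_simps)
qed simp

lemma infinitely_divisible_law:
  assumes "0 \<le> t"
  shows "infinitely_divisible (law t)"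
  unfolding infinitely_divisible_def
proof safe
  fix n :: nat assume "n \<ge> 1"
  then show "\<exists>\<nu>. borel_prob \<nu> \<and> law t = conv_power \<nu> n"
    using assms by (intro exI[of _ "law (t / real n)"]) (simp add: conv_power_law)
qed (use assms in simp)

text \<open>Convolution powers carry the moment up to a time \<open>real n * s\<close> beyond
  \<open>t\<close>, where \<open>law t\<close> is a convolution factor.\<close>

lemma log_moment_law:
  assumes "0 < s" "0 \<le> t" "log_moment (law s) < \<infinity>"
  shows "log_moment (law t) < \<infinity>"
proof -
  obtain n :: nat where n: "t < real n * s" using \<open>0 < s\<close> reals_Archimedean3 by blast
  have "log_moment (law (real n * s)) < \<infinity>"
    using assms log_moment_conv_power[of "law s" n] by (simp add: conv_power_law)
  moreover have "law (real n * s) = (law t \<star> law (real n * s - t))"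
    using law_add[of t "real n * s - t"] assms n by simp
  ultimately show ?thesis
    using assms n log_moment_convolution_left[of "law t" "law (real n * s - t)"] by simp
qed

text \<open>The laws are infinitely divisible and the logarithmic moment passes between positive
  times in both directions. This moves the condition from time 1 to the grid width
  \<open>1 / c\<close>.\<close>

lemma I_log_law_iff:
  assumes "0 < s" "0 < t"
  shows "I_log (law s) \<longleftrightarrow> log_moment (law t) < \<infinity>"
  using assms log_moment_law[of s t] log_moment_law[of t s] infinitely_divisible_law[of s]
  unfolding I_log_def log_moment_finite_iff[OF borel_prob_law[OF less_imp_le[OF assms(1)]]]
  by auto

section \<open>Weighted sums of increments over the grid\<close>

definition increment :: "real \<Rightarrow> nat \<Rightarrow> 'a \<Rightarrow> real ^ 'n" where
  "increment c k \<omega> = X (real (Suc k) / c) \<omega> - X (real k / c) \<omega>"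

lemma measurable_increment [measurable]: "c > 0 \<Longrightarrow> increment c k \<in> borel_measurable P"
  unfolding increment_def by measurable

lemma distr_increment:
  assumes "c > 0"
  shows "distr P borel (increment c k) = law (1 / c)"
proof -
  have "real (Suc k) / c - real k / c = 1 / c" by (simp add: diff_divide_distrib[symmetric])
  then show ?thesis
    using assms law_increment[of "real k / c" "real (Suc k) / c"]
    unfolding increment_def[abs_def] by (simp add: divide_right_mono)
qed

lemma distr_weighted_sum_Suc:
  assumes "c > 0"
  shows "distr P borel (\<lambda>\<omega>. \<Sum>k<Suc n. a k *\<^sub>R increment c k \<omega>)
    = (distr P borel (\<lambda>\<omega>. \<Sum>k<n. a k *\<^sub>R increment c k \<omega>) \<star> dilation (a n) (law (1 / c)))"
proof -
  \<comment> \<open>The family starts with \<open>D 0 = X 0\<close>, and \<open>D (Suc k)\<close> is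
    the \<open>k\<close>-th increment. Restricting to indices from 1 on discards \<open>X 0\<close>
    and explains the shifted weights \<open>a (k - 1)\<close>.\<close>
  define D where "D i \<omega> = (if i = 0 then X (real 0 / c) \<omega> else X (real i / c) \<omega> - X (real (i - 1) / c) \<omega>)"
    for i \<omega>
  have ind: "indep_vars (\<lambda>_. borel) (\<lambda>i \<omega>. D i \<omega>) {..Suc n}"
    unfolding D_def
    by (rule indep_vars_increments[where t = "\<lambda>i. real i / c"]) (use assms in \<open>auto simp: divide_strict_right_mono\<close>)
  have "indep_vars (\<lambda>_. borel) D (insert (Suc n) {1..n})"
    by (rule indep_vars_subset[OF ind]) auto
  from distr_sum_indep_insert[OF _ _ this, of "\<lambda>k. a (k - 1)"]
  have "distr P borel (\<lambda>\<omega>. (\<Sum>j=1..n. a (j - 1) *\<^sub>R D j \<omega>) + a n *\<^sub>R D (Suc n) \<omega>) =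
    (distr P borel (\<lambda>\<omega>. \<Sum>j=1..n. a (j - 1) *\<^sub>R D j \<omega>) \<star> dilation (a n) (distr P borel (D (Suc n))))"
    by simp
  moreover have D: "D (Suc k) = increment c k" for k
    by (simp add: D_def increment_def fun_eq_iff)
  then have "(\<Sum>j=1..n. a (j - 1) *\<^sub>R D j \<omega>) = (\<Sum>k<n. a k *\<^sub>R increment c k \<omega>)" for \<omega>
    by (simp add: sum.atLeast1_atMost_eq)
  ultimately show ?thesis using assms by (simp add: D distr_increment)
qed

text \<open>For \<open>r = inverse b\<close> this is the integral of
  \<open>b powi (- \<lfloor>c * s\<rfloor> - 1)\<close> up to the grid time
  \<open>real n / c\<close>.\<close>

definition partial_sum :: "real \<Rightarrow> real \<Rightarrow> nat \<Rightarrow> 'a \<Rightarrow> real ^ 'n" where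
  "partial_sum c r n \<omega> = (\<Sum>k<n. r ^ Suc k *\<^sub>R increment c k \<omega>)"

lemma measurable_partial_sum [measurable]: "c > 0 \<Longrightarrow> partial_sum c r n \<in> borel_measurable P"
  unfolding partial_sum_def by measurable

lemma distr_partial_sum:
  assumes "c > 0"
  shows "distr P borel (partial_sum c r n) = ar_law r (law (1 / c)) n"
proof (induction n)
  case 0
  show ?case by (simp add: partial_sum_def[abs_def])
next
  case (Suc n)
  have "distr P borel (partial_sum c r (Suc n))
      = (distr P borel (partial_sum c r n) \<star> dilation (r ^ Suc n) (law (1 / c)))"
    using distr_weighted_sum_Suc[OF assms, of "\<lambda>k. r ^ Suc k" n] unfolding partial_sum_def[abs_def] .
  then show ?case using Suc assms by (simp add: ar_law_Suc_right del: ar_law.simps)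
qed

text \<open>After scaling by \<open>inverse b ^ n\<close> the latest increment always has weight
  \<open>inverse b\<close>, so this sum obeys the recursion of \<open>ar_law\<close> directly.
  \<open>distr_partial_sum\<close> reaches the same law by appending ever smaller terms; together
  the two lemmas are the reversal of the order of summation.\<close>

lemma distr_growing_sum:
  assumes "c > 0" "b > 0"
  shows "dilation (inverse b ^ n) (distr P borel (\<lambda>\<omega>. \<Sum>k<n. b ^ k *\<^sub>R increment c k \<omega>))
    = ar_law (inverse b) (law (1 / c)) n"
proof (induction n)
  case 0
  show ?case by simp
next
  case (Suc n)
  define D where "D = distr P borel (\<lambda>\<omega>. \<Sum>k<n. b ^ k *\<^sub>R increment c k \<omega>)"
  have D: "borel_prob D"
    unfolding D_def using assms by (intro borel_prob_distr) (auto simp: prob_space_axioms)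
  have e: "inverse b ^ n * b ^ n = 1" using assms by (simp add: power_mult_distrib[symmetric])
  have "dilation (inverse b ^ Suc n) (distr P borel (\<lambda>\<omega>. \<Sum>k<Suc n. b ^ k *\<^sub>R increment c k \<omega>))
      = dilation (inverse b ^ Suc n) (D \<star> dilation (b ^ n) (law (1 / c)))"
    unfolding D_def distr_weighted_sum_Suc[OF assms(1)] ..
  also have "\<dots> = dilation (inverse b) (dilation (inverse b ^ n) D \<star> law (1 / c))"
    using D assms e by (simp add: dilation_convolution dilation_dilation mult.assoc)
  also have "dilation (inverse b ^ n) D = ar_law (inverse b) (law (1 / c)) n"
    unfolding D_def by (rule Suc)
  finally show ?case by simp
qed

text \<open>The weighted sum is measurable with respect to the sigma-algebra generated by the whole
  process, so the independence of \<open>M\<close> from the process passes to it.\<close>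

lemma distr_add_indep_of_process:
  assumes M: "M \<in> borel_measurable P" "indep_of_process P M X" and "c > 0"
  shows "distr P borel (\<lambda>\<omega>. r *\<^sub>R M \<omega> + s *\<^sub>R (\<Sum>k<n. a k *\<^sub>R increment c k \<omega>))
    = (dilation r (distr P borel M) \<star> dilation s (distr P borel (\<lambda>\<omega>. \<Sum>k<n. a k *\<^sub>R increment c k \<omega>)))"
proof -
  note [measurable] = M(1)
  define V where "V \<omega> = (\<Sum>k<n. a k *\<^sub>R increment c k \<omega>)" for \<omega>
  define G where "G = {X t -` A \<inter> space P | t A. t \<ge> 0 \<and> A \<in> sets borel}"
  \<comment> \<open>\<open>N\<close> carries the sigma-algebra of the process on the same space.
    Measurability of \<open>V\<close> with respect to \<open>N\<close>, rather than
    \<open>P\<close>, is what yields independence from \<open>M\<close>.\<close>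
  define N where "N = sigma (space P) G"
  have G: "G \<subseteq> Pow (space P)" unfolding G_def by auto
  have N: "sets N = sigma_sets (space P) G" "space N = space P"
    using G unfolding N_def by auto
  have XN [measurable]: "X t \<in> borel_measurable N" if "t \<ge> 0" for t
  proof (rule measurableI)
    fix A :: "(real ^ 'n) set" assume "A \<in> sets borel"
    then show "X t -` A \<inter> space N \<in> sets N"
      using that unfolding N by (intro sigma_sets.Basic) (auto simp: G_def)
  qed simp
  have VN: "V \<in> borel_measurable N"
    unfolding V_def[abs_def] increment_def using \<open>c > 0\<close>
    by (intro borel_measurable_sum borel_measurable_scaleR borel_measurable_diff XN borel_measurable_const) auto
  have ind0: "indep_set {M -` A \<inter> space P | A. A \<in> sets borel} (sigma_sets (space P) G)"
    using M(2) unfolding indep_of_process_def G_def .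
  have "indep_set (sigma_sets (space P) {M -` A \<inter> space P | A. A \<in> sets borel})
     (sigma_sets (space P) (sigma_sets (space P) G))"
  proof (rule indep_set_sigma_sets[OF ind0])
    show "Int_stable {M -` A \<inter> space P |A. A \<in> sets borel}"
    proof (rule Int_stableI)
      fix a b
      assume "a \<in> {M -` A \<inter> space P |A. A \<in> sets borel}" "b \<in> {M -` A \<inter> space P |A. A \<in> sets borel}"
      then obtain A B where "a = M -` A \<inter> space P" "b = M -` B \<inter> space P" "A \<in> sets borel" "B \<in> sets borel"
        by blast
      then show "a \<inter> b \<in> {M -` A \<inter> space P |A. A \<in> sets borel}"
        by (intro CollectI exI[of _ "A \<inter> B"]) auto
    qed
    show "Int_stable (sigma_sets (space P) G)"
      unfolding N(1)[symmetric] by (auto simp: Int_stable_def)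
  qed
  moreover have "sigma_sets (space P) {V -` A \<inter> space P | A. A \<in> sets borel}
      \<subseteq> sigma_sets (space P) (sigma_sets (space P) G)"
    using measurable_sets[OF VN] unfolding N by (intro sigma_sets_mono') auto
  ultimately have "indep_set (sigma_sets (space P) {M -` A \<inter> space P | A. A \<in> sets borel})
     (sigma_sets (space P) {V -` A \<inter> space P | A. A \<in> sets borel})"
    unfolding indep_sets2_eq by blast
  moreover have [measurable]: "V \<in> borel_measurable P"
    unfolding V_def[abs_def] using \<open>c > 0\<close> by measurable
  ultimately have "indep_var borel M borel V" unfolding indep_var_eq by simp
  then have "indep_var borel ((\<lambda>x. r *\<^sub>R x) \<circ> M) borel ((\<lambda>x. s *\<^sub>R x) \<circ> V)"
    by (rule indep_var_compose) auto
  then have "distr P borel (\<lambda>\<omega>. r *\<^sub>R M \<omega> + s *\<^sub>R V \<omega>)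
      = (distr P borel (\<lambda>\<omega>. r *\<^sub>R M \<omega>) \<star> distr P borel (\<lambda>\<omega>. s *\<^sub>R V \<omega>))"
    by (intro sum_indep_random_variable) (auto simp: comp_def)
  also have "\<dots> = (dilation r (distr P borel M) \<star> dilation s (distr P borel V))"
    by (simp add: dilation_distr)
  finally show ?thesis unfolding V_def[abs_def] .
qed

section \<open>Almost sure convergence and the limit law\<close>

text \<open>The logarithmic moment makes the probabilities that the \<open>k\<close>-th increment
  exceeds about \<open>b ^ (k / 2)\<close> summable. By Borel-Cantelli the terms of the series are
  eventually below a geometric sequence.\<close>

lemma AE_convergent_partial_sum:
  assumes "c > 0" "b > 1" "log_moment (law (1 / c)) < \<infinity>"
  shows "AE \<omega> in P. convergent (\<lambda>n. partial_sum c (inverse b) n \<omega>)"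
proof -
  define \<nu> where "\<nu> = law (1 / c)"
  have \<nu>: "borel_prob \<nu>" using assms by (simp add: \<nu>_def)
  interpret N: prob_space \<nu> using \<nu> by (rule borel_probD)
  note [measurable_cong] = borel_probD(3)[OF \<nu>]
  \<comment> \<open>With half of \<open>ln b\<close> as rate, the increments grow at most like
    \<open>exp (q * real (Suc k))\<close> while the weights decay like its inverse square, which
    leaves the ratio \<open>exp (- q) < 1\<close>.\<close>
  define q where "q = ln b / 2"
  have q: "q > 0" using assms by (simp add: q_def)
  define A where "A k = {\<omega> \<in> space P. q * real (Suc k) \<le> ln (1 + norm (increment c k \<omega>))}" for k
  have [measurable]: "A k \<in> sets P" for k unfolding A_def using assms(1) by measurable
  have "(\<integral>\<^sup>+x. ennreal (ln (1 + norm x)) \<partial>\<nu>) < \<infinity>"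
    using assms(3) by (simp add: log_moment_def \<nu>_def)
  then have "summable (\<lambda>k. measure \<nu> {x \<in> space \<nu>. q * real (Suc k) \<le> ln (1 + norm x)})"
    by (subst (asm) N.nn_integral_finite_iff_summable_tails[where c = q]) (use q in auto)
  moreover have "measure \<nu> {x \<in> space \<nu>. q * real (Suc k) \<le> ln (1 + norm x)} = measure P (A k)" for k
  proof -
    have "{x :: real ^ 'n. q * real (Suc k) \<le> ln (1 + norm x)} \<in> sets borel" by measurable
    then have "measure (distr P borel (increment c k)) {x. q * real (Suc k) \<le> ln (1 + norm x)}
        = measure P (A k)"
      using assms(1) by (subst measure_distr) (auto simp: A_def vimage_def Int_def conj_commute)
    then show ?thesis using assms(1) by (simp add: distr_increment \<nu>_def borel_probD)
  qed
  ultimately have sum: "summable (\<lambda>k. measure P (A k))" by simp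
  have "AE \<omega> in P. eventually (\<lambda>k. \<omega> \<in> space P - A k) sequentially"
    by (rule borel_cantelli_AE1) (auto simp: sum emeasure_eq_measure)
  then show ?thesis
  proof eventually_elim
    case (elim \<omega>)
    have "summable (\<lambda>k. inverse b ^ Suc k *\<^sub>R increment c k \<omega>)"
    proof (rule summable_comparison_test_ev)
      show "eventually (\<lambda>k. norm (inverse b ^ Suc k *\<^sub>R increment c k \<omega>) \<le> exp (- q) ^ Suc k) sequentially"
        using elim
      proof eventually_elim
        case (elim k)
        then have "exp (ln (1 + norm (increment c k \<omega>))) \<le> exp (q * real (Suc k))" by (auto simp: A_def)
        then have "1 + norm (increment c k \<omega>) \<le> exp (q * real (Suc k))"
          by (subst (asm) exp_ln) (auto intro: add_pos_nonneg)
        then have "norm (increment c k \<omega>) \<le> exp (q * real (Suc k))" by simp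
        moreover have "inverse b ^ Suc k = exp (- (2 * q) * real (Suc k))"
        proof -
          have "inverse b = exp (- (2 * q))" using assms by (simp add: q_def exp_minus)
          then show ?thesis by (simp only: exp_of_nat2_mult)
        qed
        ultimately have "norm (inverse b ^ Suc k *\<^sub>R increment c k \<omega>)
            \<le> exp (- (2 * q) * real (Suc k)) * exp (q * real (Suc k))"
          using assms by (simp add: mult_left_mono del: power_Suc of_nat_Suc)
        also have "\<dots> = exp (- q * real (Suc k))"
          by (simp add: algebra_simps flip: exp_add)
        also have "\<dots> = exp (- q) ^ Suc k" by (rule exp_of_nat2_mult)
        finally show ?case .
      qed
      show "summable (\<lambda>k. exp (- q) ^ Suc k)"
        using q by (subst summable_Suc_iff) (auto intro!: summable_geometric)
    qed
    then show ?case unfolding partial_sum_def summable_iff_convergent .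
  qed
qed

text \<open>Where the partial sums diverge, \<open>lim\<close> has an unspecified value; the
  function is nevertheless measurable everywhere, and that set is null in all uses below.\<close>

definition limit_sum :: "real \<Rightarrow> real \<Rightarrow> 'a \<Rightarrow> real ^ 'n" where
  "limit_sum c b \<omega> = lim (\<lambda>n. partial_sum c (inverse b) n \<omega>)"

lemma measurable_limit_sum [measurable]: "c > 0 \<Longrightarrow> limit_sum c b \<in> borel_measurable P"
  unfolding limit_sum_def[abs_def] by measurable

lemma AE_partial_sum_limit_sum:
  assumes "c > 0" "b > 1" "log_moment (law (1 / c)) < \<infinity>"
  shows "AE \<omega> in P. (\<lambda>n. partial_sum c (inverse b) n \<omega>) \<longlonglongrightarrow> limit_sum c b \<omega>"
  using AE_convergent_partial_sum[OF assms]
  by eventually_elim (simp add: limit_sum_def convergent_LIMSEQ_iff)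

lemma bl_converges_ar_law:
  assumes "c > 0" "b > 1" "log_moment (law (1 / c)) < \<infinity>"
  shows "bl_converges (ar_law (inverse b) (law (1 / c))) (distr P borel (limit_sum c b))"
proof -
  have "bl_converges (\<lambda>n. distr P borel (partial_sum c (inverse b) n)) (distr P borel (limit_sum c b))"
    by (rule bl_converges_AE) (use assms in \<open>auto simp: prob_space_axioms AE_partial_sum_limit_sum\<close>)
  then show ?thesis using assms by (simp add: distr_partial_sum)
qed

lemma borel_prob_limit_sum: "c > 0 \<Longrightarrow> borel_prob (distr P borel (limit_sum c b))"
  by (rule borel_prob_distr) (auto simp: prob_space_axioms)

text \<open>Both sides are limits of \<open>ar_law\<close> at \<open>Suc n\<close>: one by passing
  to the limit inside the recursion, the other by shifting the index of the convergent
  sequence.\<close>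

lemma limit_sum_fixed_point:
  assumes "c > 0" "b > 1" "log_moment (law (1 / c)) < \<infinity>"
  shows "dilation (inverse b) (distr P borel (limit_sum c b) \<star> law (1 / c)) = distr P borel (limit_sum c b)"
proof (rule bl_converges_unique)
  let ?r = "inverse b" and ?\<nu> = "law (1 / c)" and ?\<mu> = "distr P borel (limit_sum c b)"
  have "bl_converges (\<lambda>n. distr P borel (partial_sum c ?r n) \<star> ?\<nu>) (?\<mu> \<star> ?\<nu>)"
    by (rule bl_converges_convolution[OF prob_space_axioms _ _ AE_partial_sum_limit_sum[OF assms]])
       (use assms in \<open>auto simp: bl_converges_def\<close>)
  then have "bl_converges (\<lambda>n. ar_law ?r ?\<nu> n \<star> ?\<nu>) (?\<mu> \<star> ?\<nu>)"
    using assms by (simp add: distr_partial_sum)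
  then show "bl_converges (\<lambda>n. ar_law ?r ?\<nu> (Suc n)) (dilation ?r (?\<mu> \<star> ?\<nu>))"
    using assms bl_converges_dilation[of "\<lambda>n. ar_law ?r ?\<nu> n \<star> ?\<nu>" "?\<mu> \<star> ?\<nu>" ?r]
    by (simp add: borel_prob_limit_sum)
  show "bl_converges (\<lambda>n. ar_law ?r ?\<nu> (Suc n)) ?\<mu>"
    unfolding bl_converges_def
  proof (intro allI impI)
    fix f :: "real ^ 'n \<Rightarrow> real"
    assume "(\<exists>L. L-lipschitz_on UNIV f) \<and> bounded (range f)"
    then have "(\<lambda>n. \<integral>x. f x \<partial>ar_law ?r ?\<nu> n) \<longlonglongrightarrow> (\<integral>x. f x \<partial>?\<mu>)"
      using bl_converges_ar_law[OF assms] unfolding bl_converges_def by blast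
    then show "(\<lambda>n. \<integral>x. f x \<partial>ar_law ?r ?\<nu> (Suc n)) \<longlonglongrightarrow> (\<integral>x. f x \<partial>?\<mu>)"
      by (rule LIMSEQ_Suc)
  qed
qed (use assms in \<open>auto simp: borel_prob_limit_sum\<close>)

text \<open>On the grid refined by the factor \<open>m\<close>, with the same ratio
  \<open>inverse b\<close>, the innovation law is an \<open>m\<close>-th root of the original one.
  Roots pass through the recursion and then through the limit, so the root of the limit law is again
  a limit law.\<close>

lemma infinitely_divisible_limit_sum:
  assumes "c > 0" "b > 1" "log_moment (law (1 / c)) < \<infinity>"
  shows "infinitely_divisible (distr P borel (limit_sum c b))"
  unfolding infinitely_divisible_def
proof safe
  show "borel_prob (distr P borel (limit_sum c b))" using assms by (simp add: borel_prob_limit_sum)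
next
  fix m :: nat assume m: "m \<ge> 1"
  define d where "d = c * real m"
  have d: "d > 0" using assms m by (simp add: d_def)
  have lm: "log_moment (law (1 / d)) < \<infinity>"
    using log_moment_law[of "1 / c" "1 / d"] assms d by simp
  have power: "law (1 / c) = conv_power (law (1 / d)) m"
    using d assms m by (simp add: conv_power_law d_def)
  have "bl_converges (\<lambda>n. conv_power (distr P borel (partial_sum d (inverse b) n)) m)
      (conv_power (distr P borel (limit_sum d b)) m)"
    by (rule bl_converges_conv_power[OF prob_space_axioms])
       (use assms d lm in \<open>auto simp: AE_partial_sum_limit_sum\<close>)
  also have "(\<lambda>n. conv_power (distr P borel (partial_sum d (inverse b) n)) m)
      = ar_law (inverse b) (law (1 / c))"
    using d by (simp add: power ar_law_conv_power distr_partial_sum fun_eq_iff)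
  finally have "distr P borel (limit_sum c b) = conv_power (distr P borel (limit_sum d b)) m"
    by (intro bl_converges_unique[OF bl_converges_ar_law[OF assms]])
       (use assms d in \<open>auto simp: borel_prob_limit_sum\<close>)
  then show "\<exists>\<nu>. borel_prob \<nu> \<and> distr P borel (limit_sum c b) = conv_power \<nu> m"
    using d borel_prob_limit_sum by blast
qed

text \<open>Distributing the dilation over the convolution in the fixed point equation gives the
  decomposition, with \<rho> the law of one scaled innovation.\<close>

lemma semi_selfdecomposable_limit_sum:
  assumes "c > 0" "b > 1" "log_moment (law (1 / c)) < \<infinity>"
  shows "semi_selfdecomposable b (distr P borel (limit_sum c b))"
  unfolding semi_selfdecomposable_def
proof (intro conjI exI allI)
  let ?\<mu> = "distr P borel (limit_sum c b)" and ?\<rho> = "dilation (inverse b) (law (1 / c))"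
  show "infinitely_divisible ?\<rho>"
    using assms by (intro infinitely_divisible_dilation infinitely_divisible_law) simp
  fix z
  have "char_fun ?\<mu> z = char_fun (dilation (inverse b) ?\<mu> \<star> ?\<rho>) z"
    using limit_sum_fixed_point[OF assms] assms
    by (simp add: dilation_convolution borel_prob_limit_sum)
  then show "char_fun ?\<mu> z = char_fun ?\<mu> (inverse b *\<^sub>R z) * char_fun ?\<rho> z"
    using assms by (simp add: char_fun_convolution char_fun_dilation[of ?\<mu>] borel_prob_limit_sum)
qed (use assms infinitely_divisible_limit_sum in auto)

section \<open>The improper stochastic integral\<close>

lemma stochastic_continuity:
  assumes "0 \<le> t" "0 < \<epsilon>"
  shows "((\<lambda>s. measure P {\<omega> \<in> space P. norm (X s \<omega> - X t \<omega>) > \<epsilon>}) \<longlongrightarrow> 0) (at t within {0..})"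
proof -
  have "\<forall>t\<ge>0. \<forall>\<epsilon>>0. ((\<lambda>s. measure P {\<omega> \<in> space P. norm (X s \<omega> - X t \<omega>) > \<epsilon>}) \<longlongrightarrow> 0)
      (at t within {0..})"
    using levy_process unfolding levy_process_def by (elim conjE)
  then show ?thesis using assms by simp
qed

text \<open>If tightness failed, times violating it would accumulate at some \<open>l\<close> by
  compactness. Stochastic continuity brings \<open>X\<close> at these times close to
  \<open>X l\<close> in probability, and the single variable \<open>X l\<close> is tight. The lemma
  serves to control the incomplete last interval of the integral.\<close>

lemma uniformly_tight:
  assumes "\<epsilon> > 0"
  shows "\<exists>R. \<forall>s\<in>{0..T}. measure P {\<omega> \<in> space P. norm (X s \<omega>) > R} < \<epsilon>"
proof (rule ccontr)
  assume "\<not> ?thesis"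
  then have "\<forall>R. \<exists>s\<in>{0..T}. \<epsilon> \<le> measure P {\<omega> \<in> space P. norm (X s \<omega>) > R}"
    by (auto simp: not_less)
  then have "\<forall>n. \<exists>s. s \<in> {0..T} \<and> \<epsilon> \<le> measure P {\<omega> \<in> space P. norm (X s \<omega>) > real n}"
    by blast
  from choice[OF this] obtain s where s: "\<And>n. s n \<in> {0..T}"
      "\<And>n. \<epsilon> \<le> measure P {\<omega> \<in> space P. norm (X (s n) \<omega>) > real n}"
    by blast
  obtain l r where l: "l \<in> {0..T}" "strict_mono r" "(s \<circ> r) \<longlonglongrightarrow> l"
    using compact_Icc[of 0 T] s(1) unfolding compact_def by blast
  have l0: "l \<ge> 0" and s0: "s n \<ge> 0" for n using l(1) s(1)[of n] by auto
  note [measurable] = measurable_X[OF l0] measurable_X[OF s0]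
  define g where "g u = measure P {\<omega> \<in> space P. norm (X u \<omega> - X l \<omega>) > 1}" for u
  have "(g \<longlongrightarrow> 0) (at l within {0..})"
    unfolding g_def using l0 by (rule stochastic_continuity) simp
  \<comment> \<open>The limit of \<open>g\<close> ignores the point \<open>l\<close>. The value
    there turns the limit into continuity, so that the sequence of times may hit
    \<open>l\<close>.\<close>
  moreover have "g l = 0" by (simp add: g_def)
  ultimately have "continuous (at l within {0..}) g" by (simp add: continuous_within)
  then have "(g \<circ> (s \<circ> r)) \<longlonglongrightarrow> g l"
    using s0 l(3) unfolding continuous_within_sequentially by simp
  then have lim1: "(\<lambda>n. g (s (r n))) \<longlonglongrightarrow> 0" using \<open>g l = 0\<close> by (simp add: comp_def)
  \<comment> \<open>Dividing by \<open>n\<close> expresses the tightness of \<open>X l\<close> as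
    convergence to 0 in probability.\<close>
  have "tendsto_in_prob P (\<lambda>n \<omega>. (1 / real n) *\<^sub>R X l \<omega>) (\<lambda>_. 0) sequentially"
  proof (rule tendsto_in_prob_AE)
    have "(\<lambda>n. (1 / real n) *\<^sub>R X l \<omega>) \<longlonglongrightarrow> 0 *\<^sub>R X l \<omega>" for \<omega>
      by (intro tendsto_intros)
    then show "AE \<omega> in P. (\<lambda>n. (1 / real n) *\<^sub>R X l \<omega>) \<longlonglongrightarrow> 0" by simp
  qed auto
  then have lim2: "(\<lambda>n. measure P {\<omega> \<in> space P. norm ((1 / real n) *\<^sub>R X l \<omega> - 0) > 1/2}) \<longlonglongrightarrow> 0"
    unfolding tendsto_in_prob_def by (rule allE[of _ "1/2"]) simp
  have "(\<lambda>n. g (s (r n)) + measure P {\<omega> \<in> space P. norm ((1 / real n) *\<^sub>R X l \<omega> - 0) > 1/2}) \<longlonglongrightarrow> 0 + 0"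
    by (intro tendsto_add lim1 lim2)
  then have "eventually (\<lambda>n. g (s (r n)) + measure P {\<omega> \<in> space P. norm ((1 / real n) *\<^sub>R X l \<omega> - 0) > 1/2} < \<epsilon>) sequentially"
    using assms by (auto dest: order_tendstoD)
  \<comment> \<open>If \<open>X\<close> at the \<open>n\<close>-th chosen time exceeds
    \<open>real (r n)\<close>, hence \<open>n\<close>, in norm, then it is farther than 1 from
    \<open>X l\<close> or \<open>X l\<close> exceeds \<open>n - 1\<close>. From \<open>n = 3\<close>
    on, the latter is at least \<open>n / 2\<close>.\<close>
  moreover have "eventually (\<lambda>n. \<epsilon> \<le> g (s (r n)) + measure P {\<omega> \<in> space P. norm ((1 / real n) *\<^sub>R X l \<omega> - 0) > 1/2}) sequentially"
    using eventually_ge_at_top[of 3]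
  proof eventually_elim
    case (elim n)
    have "n \<le> r n" using l(2) by (rule seq_suble)
    have "\<epsilon> \<le> measure P {\<omega> \<in> space P. norm (X (s (r n)) \<omega>) > real (r n)}" by (rule s(2))
    also have "\<dots> \<le> measure P ({\<omega> \<in> space P. norm (X (s (r n)) \<omega> - X l \<omega>) > 1}
        \<union> {\<omega> \<in> space P. norm ((1 / real n) *\<^sub>R X l \<omega> - 0) > 1/2})"
    proof (rule finite_measure_mono)
      show "{\<omega> \<in> space P. norm (X (s (r n)) \<omega>) > real (r n)} \<subseteq>
        {\<omega> \<in> space P. norm (X (s (r n)) \<omega> - X l \<omega>) > 1}
        \<union> {\<omega> \<in> space P. norm ((1 / real n) *\<^sub>R X l \<omega> - 0) > 1/2}"
      proof (intro subsetI)
        fix \<omega> assume \<omega>: "\<omega> \<in> {\<omega> \<in> space P. norm (X (s (r n)) \<omega>) > real (r n)}"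
        have "norm (X (s (r n)) \<omega>) \<le> norm (X (s (r n)) \<omega> - X l \<omega>) + norm (X l \<omega>)"
          using norm_triangle_ineq[of "X (s (r n)) \<omega> - X l \<omega>" "X l \<omega>"] by simp
        moreover have "real n \<le> real (r n)" using \<open>n \<le> r n\<close> by simp
        moreover have "norm (X (s (r n)) \<omega>) > real (r n)" using \<omega> by simp
        ultimately have "norm (X (s (r n)) \<omega> - X l \<omega>) > 1 \<or> norm (X l \<omega>) > real n - 1" by linarith
        moreover have "norm ((1 / real n) *\<^sub>R X l \<omega> - 0) > 1/2" if "norm (X l \<omega>) > real n - 1"
        proof -
          have "real n / 2 < norm (X l \<omega>)" using that elim by simp
          then show ?thesis using elim by (simp add: field_simps)
        qed
        ultimately show "\<omega> \<in> {\<omega> \<in> space P. norm (X (s (r n)) \<omega> - X l \<omega>) > 1}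
          \<union> {\<omega> \<in> space P. norm ((1 / real n) *\<^sub>R X l \<omega> - 0) > 1/2}"
          using \<omega> by blast
      qed
    qed measurable
    also have "\<dots> \<le> g (s (r n)) + measure P {\<omega> \<in> space P. norm ((1 / real n) *\<^sub>R X l \<omega> - 0) > 1/2}"
      unfolding g_def by (rule measure_Un_le) measurable
    finally show ?case .
  qed
  ultimately have "eventually (\<lambda>n::nat. False) sequentially"
    by eventually_elim simp
  then show False by simp
qed

lemma step_integral_grid:
  assumes "c > 0"
  shows "step_integral c f X (real n / c) \<omega> = (\<Sum>k<n. f (real k / c) *\<^sub>R increment c k \<omega>)"
  using assms by (simp add: step_integral_def Let_def increment_def sum.atLeast1_atMost_eq)

lemma step_integral_decaying:
  assumes "c > 0" "t \<ge> 0"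
  defines "n \<equiv> nat \<lfloor>c * t\<rfloor>"
  shows "step_integral c (\<lambda>s. b powi (- \<lfloor>c * s\<rfloor> - 1)) X t \<omega>
    = partial_sum c (inverse b) n \<omega> + inverse b ^ Suc n *\<^sub>R (X t \<omega> - X (real n / c) \<omega>)"
proof -
  have powi: "b powi (- int k - 1) = inverse b ^ Suc k" for k
    using power_int_minus[of b "int (Suc k)"] by (simp add: power_inverse power_int_def nat_add_distrib)
  have "b powi (- 1 - int k) = inverse b ^ Suc k" for k
  proof -
    have "- 1 - int k = - int k - 1" by simp
    then show ?thesis by (simp only: powi)
  qed
  with powi show ?thesis
    using assms(1)
    by (simp add: step_integral_def Let_def partial_sum_def increment_def n_def[symmetric]
        sum.atLeast1_atMost_eq del: power_Suc)
qed

text \<open>At grid times the integral is a partial sum. In between, the remainder is a damping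
  factor times an increment over a time of at most \<open>1 / c\<close>; such increments are
  uniformly tight, so the remainder tends to 0 in probability.\<close>

lemma has_improper_step_integral_limit_sum:
  assumes "c > 0" "b > 1" "log_moment (law (1 / c)) < \<infinity>"
  shows "has_improper_step_integral P c (\<lambda>s. b powi (- \<lfloor>c * s\<rfloor> - 1)) X (limit_sum c b)"
  unfolding has_improper_step_integral_def tendsto_in_prob_def
proof (intro conjI allI impI)
  show Y [measurable]: "limit_sum c b \<in> borel_measurable P" using assms by simp
  fix \<epsilon> :: real assume "\<epsilon> > 0"
  define n where "n t = nat \<lfloor>c * t\<rfloor>" for t
  define A where "A m = measure P {\<omega> \<in> space P. norm (partial_sum c (inverse b) m \<omega> - limit_sum c b \<omega>) > \<epsilon> / 2}" for m
  have "tendsto_in_prob P (partial_sum c (inverse b)) (limit_sum c b) sequentially"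
    by (rule tendsto_in_prob_AE) (use assms in \<open>auto simp: AE_partial_sum_limit_sum\<close>)
  then have "A \<longlonglongrightarrow> 0"
    using \<open>\<epsilon> > 0\<close> half_gt_zero unfolding tendsto_in_prob_def A_def by blast
  then have A: "((\<lambda>t. A (n t)) \<longlongrightarrow> 0) at_top"
    unfolding n_def by (rule filterlim_compose[OF _ filterlim_nat_floor_at_top[OF assms(1)]])
  show "((\<lambda>t. measure P {\<omega> \<in> space P. norm (step_integral c (\<lambda>s. b powi (- \<lfloor>c * s\<rfloor> - 1)) X t \<omega>
      - limit_sum c b \<omega>) > \<epsilon>}) \<longlongrightarrow> 0) at_top"
  proof (rule tendstoI)
    fix \<eta> :: real assume "\<eta> > 0"
    then obtain R where R: "\<And>s. s \<in> {0..1 / c} \<Longrightarrow> measure P {\<omega> \<in> space P. norm (X s \<omega>) > R} < \<eta> / 2"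
      using uniformly_tight[of "\<eta> / 2" "1 / c"] by (metis half_gt_zero)
    have "eventually (\<lambda>t. A (n t) < \<eta> / 2) at_top"
      using \<open>\<eta> > 0\<close> by (intro order_tendstoD(2)[OF A]) simp
    \<comment> \<open>Once this holds, a remainder above \<open>\<epsilon> / 2\<close> forces the
      undamped increment above \<open>R\<close>, an event of probability less than
      \<open>\<eta> / 2\<close>.\<close>
    moreover have "eventually (\<lambda>t. R \<le> b ^ Suc (n t) * (\<epsilon> / 2)) at_top"
    proof -
      obtain N where N: "R / (\<epsilon> / 2) < b ^ N" using real_arch_pow[OF assms(2)] by blast
      have "eventually (\<lambda>t. N \<le> n t) at_top"
        using filterlim_nat_floor_at_top[OF assms(1)] unfolding n_def filterlim_at_top by blast
      then show ?thesis
      proof eventually_elim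
        case (elim t)
        then have "b ^ N \<le> b ^ Suc (n t)" using assms(2) by (intro power_increasing) auto
        then have "R / (\<epsilon> / 2) \<le> b ^ Suc (n t)" using N by linarith
        then show ?case using \<open>\<epsilon> > 0\<close> by (simp add: pos_divide_le_eq del: power_Suc)
      qed
    qed
    ultimately show "eventually (\<lambda>t. dist (measure P {\<omega> \<in> space P. norm (step_integral c (\<lambda>s. b powi (- \<lfloor>c * s\<rfloor> - 1)) X t \<omega>
      - limit_sum c b \<omega>) > \<epsilon>}) 0 < \<eta>) at_top"
      using eventually_ge_at_top[of 0]
    proof eventually_elim
      case (elim t)
      define s where "s = t - real (n t) / c"
      have nt: "real (n t) \<le> c * t" "c * t < real (n t) + 1"
        using elim assms(1) unfolding n_def by (simp_all add: of_nat_nat)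
      have le: "real (n t) / c \<le> t"
        using nt(1) assms(1) by (simp add: pos_divide_le_eq mult.commute)
      have "t < (real (n t) + 1) / c"
        using nt(2) assms(1) by (simp add: pos_less_divide_eq mult.commute)
      then have s: "s \<in> {0..1 / c}" using le by (simp add: s_def add_divide_distrib)
      have [measurable]: "X t \<in> borel_measurable P" "X (real (n t) / c) \<in> borel_measurable P"
          "X s \<in> borel_measurable P" "partial_sum c (inverse b) (n t) \<in> borel_measurable P"
        using elim assms(1) s by auto
      let ?B = "{\<omega> \<in> space P. norm (X t \<omega> - X (real (n t) / c) \<omega>) > R}"
      have B: "measure P ?B < \<eta> / 2"
      proof -
        have S: "{x :: real ^ 'n. norm x > R} \<in> sets borel" by measurable
        have "measure P ?B = measure (distr P borel (\<lambda>\<omega>. X t \<omega> - X (real (n t) / c) \<omega>)) {x. norm x > R}"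
          using S by (subst measure_distr) (auto simp: vimage_def Int_def conj_commute)
        also have "\<dots> = measure (distr P borel (X s)) {x. norm x > R}"
          using law_increment[of "real (n t) / c" t] le assms(1) by (simp add: s_def law_def)
        also have "\<dots> = measure P {\<omega> \<in> space P. norm (X s \<omega>) > R}"
          using S by (subst measure_distr) (auto simp: vimage_def Int_def conj_commute)
        also have "\<dots> < \<eta> / 2" using s by (rule R)
        finally show ?thesis .
      qed
      let ?A = "{\<omega> \<in> space P. norm (partial_sum c (inverse b) (n t) \<omega> - limit_sum c b \<omega>) > \<epsilon> / 2}"
      have "measure P {\<omega> \<in> space P. norm (step_integral c (\<lambda>s. b powi (- \<lfloor>c * s\<rfloor> - 1)) X t \<omega> - limit_sum c b \<omega>) > \<epsilon>}
          \<le> measure P (?A \<union> ?B)"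
      proof (rule finite_measure_mono)
        show "{\<omega> \<in> space P. norm (step_integral c (\<lambda>s. b powi (- \<lfloor>c * s\<rfloor> - 1)) X t \<omega> - limit_sum c b \<omega>) > \<epsilon>}
            \<subseteq> ?A \<union> ?B"
        proof (intro subsetI)
          fix \<omega> assume \<omega>: "\<omega> \<in> {\<omega> \<in> space P. norm (step_integral c (\<lambda>s. b powi (- \<lfloor>c * s\<rfloor> - 1)) X t \<omega> - limit_sum c b \<omega>) > \<epsilon>}"
          let ?D = "X t \<omega> - X (real (n t) / c) \<omega>"
          let ?E = "partial_sum c (inverse b) (n t) \<omega> - limit_sum c b \<omega>"
          have "step_integral c (\<lambda>s. b powi (- \<lfloor>c * s\<rfloor> - 1)) X t \<omega> - limit_sum c b \<omega>
              = ?E + inverse b ^ Suc (n t) *\<^sub>R ?D"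
            unfolding step_integral_decaying[OF assms(1) elim(3)] n_def by (simp only: diff_add_eq)
          then have "\<epsilon> < norm (?E + inverse b ^ Suc (n t) *\<^sub>R ?D)"
            using \<omega> by (metis (no_types, lifting) mem_Collect_eq)
          also have "\<dots> \<le> norm ?E + norm (inverse b ^ Suc (n t) *\<^sub>R ?D)" by (rule norm_triangle_ineq)
          also have "norm (inverse b ^ Suc (n t) *\<^sub>R ?D) = norm ?D / b ^ Suc (n t)"
            using assms(2) by (simp add: power_inverse divide_inverse abs_mult)
          finally have "norm ?E > \<epsilon> / 2 \<or> norm ?D / b ^ Suc (n t) > \<epsilon> / 2" by linarith
          moreover have "norm ?D > R" if "norm ?D / b ^ Suc (n t) > \<epsilon> / 2"
          proof -
            have "\<epsilon> / 2 * b ^ Suc (n t) < norm ?D"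
              using that assms(2) by (simp add: pos_less_divide_eq del: power_Suc)
            then show ?thesis using elim(2) by (simp add: mult.commute)
          qed
          ultimately show "\<omega> \<in> ?A \<union> ?B" using \<omega> by blast
        qed
      qed measurable
      also have "\<dots> \<le> measure P ?A + measure P ?B" by (rule measure_Un_le) measurable
      also have "\<dots> < \<eta>" using B elim(1) by (simp add: A_def)
      finally show ?case by simp
    qed
  qed
qed

section \<open>The limit law of the process Z\<close>

lemma distr_Z_proc:
  assumes "c > 0" "b > 1" "M \<in> borel_measurable P" "indep_of_process P M X" "t \<ge> 0"
  shows "distr P borel (Z_proc c b X M t)
    = (dilation (inverse b ^ nat \<lfloor>c * t\<rfloor>) (distr P borel M) \<star> ar_law (inverse b) (law (1 / c)) (nat \<lfloor>c * t\<rfloor>))"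
proof -
  define n where "n = nat \<lfloor>c * t\<rfloor>"
  have fl: "\<lfloor>c * t\<rfloor> = int n" using assms by (simp add: n_def)
  have f: "b powi \<lfloor>c * (real k / c)\<rfloor> = b ^ k" for k using assms(1) by simp
  have "Z_proc c b X M t = (\<lambda>\<omega>. inverse b ^ n *\<^sub>R M \<omega>
      + inverse b ^ n *\<^sub>R (\<Sum>k<n. b ^ k *\<^sub>R increment c k \<omega>))"
    unfolding Z_proc_def fun_eq_iff fl of_int_of_nat_eq step_integral_grid[OF assms(1)] f
    by (simp add: power_int_minus power_inverse)
  then show ?thesis
    using assms by (simp add: distr_add_indep_of_process distr_growing_sum n_def[symmetric])
qed

text \<open>Convergence in law may be checked on variables with the same laws. In \<open>U n\<close>
  the sum is replaced by the forward partial sum, which converges almost surely, while the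
  contribution of \<open>M\<close> is scaled to 0.\<close>

lemma Z_limit_limit_sum:
  assumes "c > 0" "b > 1" and M: "M \<in> borel_measurable P" "indep_of_process P M X"
    and lm: "log_moment (law (1 / c)) < \<infinity>"
  shows "Z_limit P c b X M (distr P borel (limit_sum c b))"
proof -
  note [measurable] = M(1)
  let ?r = "inverse b"
  define U where "U n \<omega> = ?r ^ n *\<^sub>R M \<omega> + partial_sum c ?r n \<omega>" for n \<omega>
  have U: "distr P borel (Z_proc c b X M t) = distr P borel (U (nat \<lfloor>c * t\<rfloor>))" if "t \<ge> 0" for t
  proof -
    have "distr P borel (U n) = (dilation (?r ^ n) (distr P borel M) \<star> ar_law ?r (law (1 / c)) n)" for n
    proof -
      have "distr P borel (U n) = (dilation (?r ^ n) (distr P borel M) \<star>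
          dilation 1 (distr P borel (partial_sum c ?r n)))"
        unfolding U_def[abs_def] partial_sum_def[abs_def]
        using distr_add_indep_of_process[OF M assms(1), of "?r ^ n" 1 "\<lambda>k. ?r ^ Suc k" n] by simp
      then show ?thesis using assms(1) by (simp add: distr_partial_sum)
    qed
    then show ?thesis using assms that by (simp add: distr_Z_proc)
  qed
  have "weakly_converges (\<lambda>n. distr P borel (U n)) (distr P borel (limit_sum c b)) sequentially"
  proof (rule bl_converges_AE(2))
    show "AE \<omega> in P. (\<lambda>n. U n \<omega>) \<longlonglongrightarrow> limit_sum c b \<omega>"
      using AE_partial_sum_limit_sum[OF assms(1,2) lm]
    proof eventually_elim
      case (elim \<omega>)
      have "\<bar>?r\<bar> < 1" using assms(2) by (simp add: inverse_less_1_iff)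
      then have "(\<lambda>n. ?r ^ n) \<longlonglongrightarrow> 0" by (rule LIMSEQ_abs_realpow_zero2)
      then have "(\<lambda>n. U n \<omega>) \<longlonglongrightarrow> 0 *\<^sub>R M \<omega> + limit_sum c b \<omega>"
        unfolding U_def by (intro tendsto_add tendsto_scaleR tendsto_const elim)
      then show ?case by simp
    qed
    show "U n \<in> borel_measurable P" for n
      unfolding U_def[abs_def] using assms(1) by measurable
  qed (use assms in \<open>auto simp: prob_space_axioms\<close>)
  then have "weakly_converges (\<lambda>t. distr P borel (Z_proc c b X M t)) (distr P borel (limit_sum c b)) at_top"
    using U by (subst weakly_converges_floor_iff[where c = c and \<nu> = "\<lambda>n. distr P borel (U n)"])
      (use assms(1) in auto)
  then show ?thesis using assms by (simp add: Z_limit_def borel_prob_limit_sum)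
qed

text \<open>In modulus the characteristic function of \<open>\<zeta> m\<close> is at most that of
  the \<open>m\<close>-th iterate, hence at most that of the \<open>n\<close>-th for
  \<open>m \<ge> n\<close>. Letting \<open>m\<close> tend to infinity with \<open>n\<close> fixed
  gives the domination by which the limit forces the moment.\<close>

lemma log_moment_of_Z_limit:
  assumes "c > 0" "b > 1" and M: "M \<in> borel_measurable P" "indep_of_process P M X"
    and Z: "Z_limit P c b X M \<mu>"
  shows "log_moment (law (1 / c)) < \<infinity>"
proof -
  let ?r = "inverse b" and ?\<nu> = "law (1 / c)"
  define \<zeta> where "\<zeta> n = (dilation (?r ^ n) (distr P borel M) \<star> ar_law ?r ?\<nu> n)" for n
  have bM: "borel_prob (distr P borel M)"
    using M by (intro borel_prob_distr) (auto simp: prob_space_axioms)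
  have b\<nu>: "borel_prob ?\<nu>" using assms by simp
  have b\<zeta>: "borel_prob (\<zeta> n)" for n unfolding \<zeta>_def using bM b\<nu> by simp
  have b\<mu>: "borel_prob \<mu>" and "weakly_converges (\<lambda>t. distr P borel (Z_proc c b X M t)) \<mu> at_top"
    using Z by (auto simp: Z_limit_def)
  then have "weakly_converges \<zeta> \<mu> sequentially"
    by (subst (asm) weakly_converges_floor_iff[where c = c and \<nu> = \<zeta>])
       (use assms in \<open>auto simp: distr_Z_proc \<zeta>_def\<close>)
  note lim = tendsto_norm[OF tendsto_char_fun[OF this b\<zeta> b\<mu>]]
  show ?thesis
  proof (rule log_moment_finite_of_char_fun_bound[OF b\<nu> assms(2) b\<mu>])
    fix z n
    show "cmod (char_fun \<mu> z) \<le> cmod (char_fun (ar_law ?r ?\<nu> n) z)"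
    proof (rule tendsto_upperbound[OF lim])
      show "eventually (\<lambda>m. cmod (char_fun (\<zeta> m) z) \<le> cmod (char_fun (ar_law ?r ?\<nu> n) z)) sequentially"
        using eventually_ge_at_top[of n]
      proof eventually_elim
        case (elim m)
        have "cmod (char_fun (\<zeta> m) z)
            = cmod (char_fun (dilation (?r ^ m) (distr P borel M)) z) * cmod (char_fun (ar_law ?r ?\<nu> m) z)"
          unfolding \<zeta>_def using bM b\<nu> by (simp add: char_fun_convolution norm_mult)
        also have "\<dots> \<le> cmod (char_fun (ar_law ?r ?\<nu> m) z)"
          using cmod_char_fun_le_1[of "dilation (?r ^ m) (distr P borel M)"] bM
          by (intro mult_left_le_one_le) auto
        also have "\<dots> \<le> cmod (char_fun (ar_law ?r ?\<nu> n) z)"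
          by (rule cmod_char_fun_ar_law_antimono[OF b\<nu> elim])
        finally show ?case .
      qed
    qed simp
  qed
qed

lemma Z_limit_unique:
  assumes "Z_limit P c b X M \<mu>" "Z_limit P c b X M \<mu>'"
  shows "\<mu> = \<mu>'"
proof (rule borel_prob_eqI_lipschitz)
  fix f :: "real ^ 'n \<Rightarrow> real"
  assume "\<exists>L. L-lipschitz_on UNIV f" "bounded (range f)"
  then have "continuous_on UNIV f \<and> bounded (range f)" by (auto intro: lipschitz_on_continuous_on)
  then have "((\<lambda>t. \<integral>x. f x \<partial>distr P borel (Z_proc c b X M t)) \<longlongrightarrow> (\<integral>x. f x \<partial>\<mu>)) at_top"
    "((\<lambda>t. \<integral>x. f x \<partial>distr P borel (Z_proc c b X M t)) \<longlongrightarrow> (\<integral>x. f x \<partial>\<mu>')) at_top"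
    using assms unfolding Z_limit_def weakly_converges_def by blast+
  then show "(\<integral>x. f x \<partial>\<mu>) = (\<integral>x. f x \<partial>\<mu>')" by (rule tendsto_unique[rotated]) simp
qed (use assms in \<open>auto simp: Z_limit_def\<close>)

end

theorem theorem5p1:
  fixes P :: "'a measure"
    and X :: "real \<Rightarrow> 'a \<Rightarrow> real ^ 'n"
    and M :: "'a \<Rightarrow> real ^ 'n"
    and c b :: real
  assumes "levy_process P X"
    and "c > 0" and "b > 1"
    and "M \<in> borel_measurable P"
    and "indep_of_process P M X"
  shows "(I_log (distr P borel (X 1)) \<longleftrightarrow> (\<exists>\<mu>. Z_limit P c b X M \<mu>)) \<and>
    (\<forall>\<mu>. Z_limit P c b X M \<mu> \<longrightarrow>
       (\<exists>Y. has_improper_step_integral P c (\<lambda>s. b powi (- \<lfloor>c * s\<rfloor> - 1)) X Y \<and>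
            \<mu> = distr P borel Y) \<and>
       semi_selfdecomposable b \<mu> \<and>
       (\<forall>M'. M' \<in> borel_measurable P \<and> indep_of_process P M' X \<longrightarrow>
          Z_limit P c b X M' \<mu>) \<and>
       (\<forall>M'. M' \<in> borel_measurable P \<and> indep_of_process P M' X \<and> distr P borel M' = \<mu> \<longrightarrow>
          (\<forall>t\<ge>0. distr P borel (Z_proc c b X M' t) = \<mu>)))"
proof -
  interpret levy P X by unfold_locales fact
  note c = \<open>c > 0\<close> and b = \<open>b > 1\<close>
  let ?\<mu> = "distr P borel (limit_sum c b)"
  have I_log: "I_log (distr P borel (X 1)) \<longleftrightarrow> log_moment (law (1 / c)) < \<infinity>"
    using I_log_law_iff[of 1 "1 / c"] c by (simp add: law_def)
  \<comment> \<open>Any limit law forces the logarithmic moment, and then uniqueness identifies it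
    with the law of \<open>limit_sum c b\<close>. The claims about an arbitrary limit thereby become
    claims about this one law.\<close>
  have limit: "log_moment (law (1 / c)) < \<infinity>" "\<mu> = ?\<mu>" if "Z_limit P c b X M \<mu>" for \<mu>
  proof -
    show lm: "log_moment (law (1 / c)) < \<infinity>"
      by (rule log_moment_of_Z_limit[OF c b assms(4,5) that])
    show "\<mu> = ?\<mu>"
      by (rule Z_limit_unique[OF that Z_limit_limit_sum[OF c b assms(4,5) lm]])
  qed
  show ?thesis
  proof (intro conjI allI impI)
    show "I_log (distr P borel (X 1)) \<longleftrightarrow> (\<exists>\<mu>. Z_limit P c b X M \<mu>)"
      unfolding I_log using limit(1) Z_limit_limit_sum[OF c b assms(4,5)] by blast
  next
    fix \<mu> assume Z: "Z_limit P c b X M \<mu>"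
    note lm = limit(1)[OF Z] and \<mu> = limit(2)[OF Z]
    show "\<exists>Y. has_improper_step_integral P c (\<lambda>s. b powi (- \<lfloor>c * s\<rfloor> - 1)) X Y \<and> \<mu> = distr P borel Y"
      using has_improper_step_integral_limit_sum[OF c b lm] \<mu> by blast
    show "semi_selfdecomposable b \<mu>"
      unfolding \<mu> by (rule semi_selfdecomposable_limit_sum[OF c b lm])
    show "Z_limit P c b X M' \<mu>" if "M' \<in> borel_measurable P \<and> indep_of_process P M' X" for M'
      unfolding \<mu> using that Z_limit_limit_sum[OF c b _ _ lm] by blast
    fix M' and t :: real
    assume M': "M' \<in> borel_measurable P \<and> indep_of_process P M' X \<and> distr P borel M' = \<mu>" and "t \<ge> 0"
    then have "distr P borel (Z_proc c b X M' t)
        = (dilation (inverse b ^ nat \<lfloor>c * t\<rfloor>) \<mu> \<star> ar_law (inverse b) (law (1 / c)) (nat \<lfloor>c * t\<rfloor>))"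
      using distr_Z_proc[OF c b, of M' t] by simp
    \<comment> \<open>The law \<mu> is invariant under one step of the recursion, hence under all
      steps completed by time \<open>t\<close>.\<close>
    also have "\<dots> = \<mu>"
      using c limit_sum_fixed_point[OF c b lm]
      by (intro ar_law_fixed_point) (simp_all add: \<mu> borel_prob_limit_sum)
    finally show "distr P borel (Z_proc c b X M' t) = \<mu>" .
  qed
qed

end
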